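(* For a stable solution $u$ of $\Delta u=\frac1u$ on $\Omega\subset\mathbb{R}^n$ with boundary data $\varphi\le M$, and for every $0<\alpha<1$ and $\tilde\Omega\subset\subset\Omega$, there is a constant $C(n,M,\alpha,\tilde\Omega)$ such that for all $x,y\in\tilde\Omega$, $|u(x)-u(y)|\le C|x-y|^\alpha$.
   Context: $\Omega$ is a domain in $\mathbb{R}^n$. A stable solution is a positive smooth solution $u$ of $\Delta u=\frac1u$ on $\Omega$ satisfying $\int_\Omega \frac{\zeta^2}{u^2}\le\int_\Omega|D\zeta|^2$ for all (compactly supported) test functions $\zeta$ on $\Omega$. The boundary data $\varphi$ are the values of $u$ on $\partial\Omega$.
   Formalization: On an unbounded domain the bound M is also required at infinity (limsup of u at most M); without it the claim fails, e.g. for u''=1/u on the half-line with u(0)=1 and u'(0)=s≥2 arbitrary. For bounded domains nothing is added. *)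

theory Defs
  imports "HOL-Analysis.Analysis"
begin

definition partial_deriv :: "'a::euclidean_space \<Rightarrow> ('a \<Rightarrow> real) \<Rightarrow> 'a \<Rightarrow> real" where
  "partial_deriv i f x = frechet_derivative f (at x) i"

definition grad :: "('a::euclidean_space \<Rightarrow> real) \<Rightarrow> 'a \<Rightarrow> 'a" where
  "grad f x = (\<Sum>i\<in>Basis. partial_deriv i f x *\<^sub>R i)"

definition laplacian :: "('a::euclidean_space \<Rightarrow> real) \<Rightarrow> 'a \<Rightarrow> real" where
  "laplacian f x = (\<Sum>i\<in>Basis. partial_deriv i (partial_deriv i f) x)"

text \<open>Class \<open>C\<^sup>k\<close> on a set; meant for open sets only, as it uses derivatives at points
  with respect to full neighbourhoods.\<close>

fun Ck_on :: "nat \<Rightarrow> 'a::euclidean_space set \<Rightarrow> ('a \<Rightarrow> real) \<Rightarrow> bool" where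
  "Ck_on 0 S f \<longleftrightarrow> continuous_on S f"
| "Ck_on (Suc k) S f \<longleftrightarrow>
     (\<forall>x\<in>S. f differentiable (at x)) \<and> (\<forall>i\<in>Basis. Ck_on k S (partial_deriv i f))"

definition smooth_on :: "'a::euclidean_space set \<Rightarrow> ('a \<Rightarrow> real) \<Rightarrow> bool" where
  "smooth_on S f \<longleftrightarrow> (\<forall>k. Ck_on k S f)"

definition test_function :: "'a::euclidean_space set \<Rightarrow> ('a \<Rightarrow> real) \<Rightarrow> bool" where
  "test_function \<Omega> \<zeta> \<longleftrightarrow>
     smooth_on UNIV \<zeta> \<and> compact (closure {x. \<zeta> x \<noteq> 0}) \<and> closure {x. \<zeta> x \<noteq> 0} \<subseteq> \<Omega>"

text \<open>Both integrands below are continuous on \<open>\<Omega>\<close> with compact support in \<open>\<Omega>\<close>, so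
  the integrals exist and the totalised value of the Bochner integral plays no role.\<close>

definition stable_solution :: "'a::euclidean_space set \<Rightarrow> ('a \<Rightarrow> real) \<Rightarrow> bool" where
  "stable_solution \<Omega> u \<longleftrightarrow>
     smooth_on \<Omega> u \<and>
     (\<forall>x\<in>\<Omega>. 0 < u x) \<and>
     (\<forall>x\<in>\<Omega>. laplacian u x = 1 / u x) \<and>
     (\<forall>\<zeta>. test_function \<Omega> \<zeta> \<longrightarrow>
        (LINT x:\<Omega>|lborel. (\<zeta> x)\<^sup>2 / (u x)\<^sup>2) \<le> (LINT x:\<Omega>|lborel. (norm (grad \<zeta> x))\<^sup>2))"

definition has_boundary_data :: "'a::euclidean_space set \<Rightarrow> ('a \<Rightarrow> real) \<Rightarrow> ('a \<Rightarrow> real) \<Rightarrow> bool" where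
  "has_boundary_data \<Omega> u \<phi> \<longleftrightarrow> continuous_on (closure \<Omega>) u \<and> (\<forall>x\<in>frontier \<Omega>. u x = \<phi> x)"

text \<open>On an unbounded domain the point at infinity belongs to the boundary, and a bound for the
  boundary data has to include it: \<open>limsup u \<le> M\<close> as \<open>x \<rightarrow> \<infinity>\<close> in \<open>\<Omega>\<close>. Otherwise the solutions
  of \<open>u'' = 1/u\<close> on the half-line with \<open>u 0 = 1\<close> and \<open>u' 0 = s\<close>, which by Hardy's inequality
  are stable for all \<open>s \<ge> 2\<close>, satisfy no common Hoelder estimate. On a bounded domain the
  condition is void.\<close>

definition limsup_at_infinity_le :: "'a::euclidean_space set \<Rightarrow> ('a \<Rightarrow> real) \<Rightarrow> real \<Rightarrow> bool" where
  "limsup_at_infinity_le \<Omega> u M \<longleftrightarrow>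
     (\<forall>e>0. eventually (\<lambda>x. x \<in> \<Omega> \<longrightarrow> u x \<le> M + e) at_infinity)"

lemma limsup_at_infinity_le_bounded:
  assumes "bounded \<Omega>"
  shows "limsup_at_infinity_le \<Omega> u M"
proof -
  obtain b where b: "\<forall>x\<in>\<Omega>. norm x \<le> b"
    using assms by (auto simp: bounded_iff)
  have "x \<notin> \<Omega>" if "b + 1 \<le> norm x" for x
    using b that by force
  then show ?thesis
    unfolding limsup_at_infinity_le_def eventually_at_infinity by blast
qed

end

theory Submission
  imports Defs "HOL-Computational_Algebra.Polynomial"
begin

text \<open>
  By the maximum principle \<open>0 < u \<le> M\<close>, so only the behaviour at small scales matters. There the
  estimate rests on one consequence of stability: testing with a cutoff of a ball of radius \<open>s\<close> bounds
  the mean of \<open>1/u\<^sup>2\<close> over smaller concentric balls by \<open>C/s\<^sup>2\<close>, hence the mean of \<open>\<Delta>u = 1/u\<close> by \<open>C/s\<close>,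
  where \<open>C\<close> stands for various constants that depend on the dimension alone
  (\<open>stable_solution_laplacian_mass\<close>).

  The mean of \<open>\<Delta>u\<close> governs how fast radial averages of \<open>u\<close> change with the radius. Let \<open>\<Psi>\<close> be a smooth radial
  cutoff of the unit ball and let the weight \<open>\<Phi>\<close> satisfy \<open>D\<Psi>(z) = - 2 \<Phi>(z) z\<close>. The average
  \<open>A(s) = \<integral> \<Phi>(z) u(a + s z) dz\<close> has, after one integration by parts, the derivative
  \<open>A'(s) = (s/2) \<integral> \<Psi>(z) \<Delta>u(a + s z) dz\<close>, which therefore lies in a fixed interval \<open>[0, C]\<close>. So the average
  at radius \<open>s\<close> differs from \<open>u(a)\<close>, times the mass of \<open>\<Phi>\<close>, by at most \<open>C s\<close>
  (\<open>stable_solution_radial_average\<close>).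

  Averages at two nearby centres are close because their kernels overlap: they differ by at most
  \<open>C |x - y| / s\<close> times the oscillation of \<open>u\<close> on the ball of radius \<open>2s\<close>. Together this gives
  \<open>|u(x) - u(y)| \<le> C s + C (|x - y|/s) osc\<close> (\<open>stable_solution_oscillation_step\<close>). Iterating over the scales \<open>q\<^sup>k \<rho>\<close>
  around a fixed \<open>x\<close>, the oscillation decays like \<open>(q powr \<alpha>)\<^sup>k\<close> once \<open>q\<close> is so small that
  \<open>4 C q \<le> q powr \<alpha>\<close>; this is possible for every \<open>\<alpha> < 1\<close>, and it is the Hoelder estimate.
\<close>

section \<open>Partial derivatives and smooth functions\<close>

lemma has_derivative_partial_deriv:
  fixes f :: "'a::euclidean_space \<Rightarrow> real"
  assumes "f differentiable (at x)"
  shows "(f has_derivative (\<lambda>h. \<Sum>i\<in>Basis. (h \<bullet> i) * partial_deriv i f x)) (at x)"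
proof -
  have D: "(f has_derivative frechet_derivative f (at x)) (at x)"
    using assms frechet_derivative_works by blast
  then have lin: "linear (frechet_derivative f (at x))"
    by (rule has_derivative_linear)
  have "frechet_derivative f (at x) h = (\<Sum>i\<in>Basis. (h \<bullet> i) * partial_deriv i f x)" for h
  proof -
    have "frechet_derivative f (at x) h = frechet_derivative f (at x) (\<Sum>i\<in>Basis. (h \<bullet> i) *\<^sub>R i)"
      by (simp add: euclidean_representation)
    also have "\<dots> = (\<Sum>i\<in>Basis. (h \<bullet> i) * partial_deriv i f x)"
      by (simp add: linear_sum[OF lin] linear_cmul[OF lin] partial_deriv_def)
    finally show ?thesis .
  qed
  then show ?thesis using D by presburger
qed

lemma partial_deriv_eqI:
  assumes "(f has_derivative f') (at x)"
  shows "partial_deriv i f x = f' i"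
  using frechet_derivative_at[OF assms] by (simp add: partial_deriv_def)

lemma DERIV_along_line:
  fixes f :: "'a::euclidean_space \<Rightarrow> real"
  assumes "f differentiable (at (a + t *\<^sub>R h))"
  shows "((\<lambda>t. f (a + t *\<^sub>R h)) has_real_derivative
           (\<Sum>i\<in>Basis. (h \<bullet> i) * partial_deriv i f (a + t *\<^sub>R h))) (at t within T)"
proof -
  let ?F = "\<lambda>h'. \<Sum>i\<in>Basis. (h' \<bullet> i) * partial_deriv i f (a + t *\<^sub>R h)"
  have "((\<lambda>t. a + t *\<^sub>R h) has_derivative (\<lambda>d. d *\<^sub>R h)) (at t within T)"
    by (auto intro!: derivative_eq_intros)
  from has_derivative_compose[OF this has_derivative_partial_deriv[OF assms]]
  have "((\<lambda>t. f (a + t *\<^sub>R h)) has_derivative (\<lambda>d. ?F (d *\<^sub>R h))) (at t within T)"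
    by simp
  moreover have "(\<lambda>d. ?F (d *\<^sub>R h)) = (*) (?F h)"
    by (auto simp: fun_eq_iff sum_distrib_left sum_distrib_right algebra_simps)
  ultimately show ?thesis
    by (simp add: has_field_derivative_def)
qed

lemma DERIV_along_axis:
  fixes f :: "'a::euclidean_space \<Rightarrow> real"
  assumes "f differentiable (at (a + t *\<^sub>R i))" "i \<in> Basis"
  shows "((\<lambda>t. f (a + t *\<^sub>R i)) has_real_derivative partial_deriv i f (a + t *\<^sub>R i))
           (at t within T)"
proof -
  have "(\<Sum>j\<in>Basis. (i \<bullet> j) * partial_deriv j f (a + t *\<^sub>R i)) = 
      (\<Sum>j\<in>Basis. if j = i then partial_deriv j f (a + t *\<^sub>R i) else 0)"
    using assms(2) by (intro sum.cong) (auto simp: inner_Basis)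
  also have "\<dots> = partial_deriv i f (a + t *\<^sub>R i)"
    using assms(2) by simp
  finally show ?thesis using DERIV_along_line[OF assms(1), of T] by simp
qed

lemma smooth_onD:
  assumes "smooth_on S f"
  shows "\<And>x. x \<in> S \<Longrightarrow> f differentiable (at x)"
    and "\<And>i x. i \<in> Basis \<Longrightarrow> x \<in> S \<Longrightarrow> partial_deriv i f differentiable (at x)"
    and "\<And>i. i \<in> Basis \<Longrightarrow> smooth_on S (partial_deriv i f)"
    and "continuous_on S f"
proof -
  have *: "Ck_on (Suc (Suc 0)) S f" "\<And>k. Ck_on (Suc k) S f" "Ck_on 0 S f"
    using assms unfolding smooth_on_def by blast+
  show "\<And>x. x \<in> S \<Longrightarrow> f differentiable (at x)"
    "\<And>i x. i \<in> Basis \<Longrightarrow> x \<in> S \<Longrightarrow> partial_deriv i f differentiable (at x)"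
    "continuous_on S f"
    using *(1,3) by auto
  show "\<And>i. i \<in> Basis \<Longrightarrow> smooth_on S (partial_deriv i f)"
    using *(2) unfolding smooth_on_def by auto
qed

section \<open>The maximum principle\<close>

text \<open>If the second derivative at a maximum were positive, the first derivative, which vanishes there,
  would be positive immediately to the right, and the mean value theorem would produce a larger
  value.\<close>

lemma DERIV2_nonpos_at_local_max:
  fixes h h' :: "real \<Rightarrow> real"
  assumes "e > 0"
    and h: "\<And>t. \<bar>t\<bar> < e \<Longrightarrow> (h has_real_derivative h' t) (at t)"
    and h2: "(h' has_real_derivative l) (at 0)"
    and max: "\<And>t. \<bar>t\<bar> < e \<Longrightarrow> h t \<le> h 0"
  shows "l \<le> 0"
proof (rule ccontr)
  assume "\<not> l \<le> 0"
  have "h' 0 = 0"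
    using DERIV_local_max[OF h[of 0] \<open>e > 0\<close>] max \<open>e > 0\<close> by simp
  moreover obtain d where d: "d > 0" "\<And>t. 0 < t \<Longrightarrow> t < d \<Longrightarrow> h' 0 < h' (0 + t)"
    using DERIV_pos_inc_right[OF h2] \<open>\<not> l \<le> 0\<close> by auto
  define b where "b = min d e / 2"
  have b: "0 < b" "b < d" "b < e" using d(1) \<open>e > 0\<close> by (auto simp: b_def)
  have "\<exists>z>0. z < b \<and> h b - h 0 = (b - 0) * h' z"
    by (rule MVT2) (use b in \<open>auto intro!: h\<close>)
  then obtain z where "0 < z" "z < b" "h b - h 0 = b * h' z" by auto
  moreover have "h' z > 0" using d(2)[of z] calculation b by simp
  ultimately show False using max[of b] b by (smt (verit) mult_pos_pos)
qed

lemma laplacian_nonpos_at_max: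
  assumes "open S" "smooth_on S f" "x \<in> S" "\<And>y. y \<in> S \<Longrightarrow> f y \<le> f x"
  shows "laplacian f x \<le> 0"
  unfolding laplacian_def
proof (rule sum_nonpos)
  fix i :: 'a assume i: "i \<in> Basis"
  obtain e where e: "e > 0" "ball x e \<subseteq> S"
    using assms(1,3) open_contains_ball by blast
  have inS: "x + t *\<^sub>R i \<in> S" if "\<bar>t\<bar> < e" for t
    using e(2) that i by (auto simp: dist_norm subset_iff)
  show "partial_deriv i (partial_deriv i f) x \<le> 0"
  proof (rule DERIV2_nonpos_at_local_max[OF e(1)])
    show "((\<lambda>t. f (x + t *\<^sub>R i)) has_real_derivative partial_deriv i f (x + t *\<^sub>R i)) (at t)"
      if "\<bar>t\<bar> < e" for t
      using DERIV_along_axis[OF smooth_onD(1)[OF assms(2) inS[OF that]] i] .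
    show "((\<lambda>t. partial_deriv i f (x + t *\<^sub>R i)) has_real_derivative
        partial_deriv i (partial_deriv i f) x) (at 0)"
      using DERIV_along_axis[OF smooth_onD(2)[OF assms(2) i inS[of 0]] i] e(1) by simp
    show "f (x + t *\<^sub>R i) \<le> f (x + 0 *\<^sub>R i)" if "\<bar>t\<bar> < e" for t
      using assms(4) inS[OF that] by simp
  qed
qed

text \<open>Since \<open>\<Delta>u = 1/u > 0\<close>, the solution has no interior maximum. A value above \<open>M\<close> would force one:
  the bound at infinity confines the competition to a compact part of the closure, where
  the maximum is attained, and the boundary data exclude the frontier.\<close>

lemma stable_solution_le:
  fixes u :: "'a::euclidean_space \<Rightarrow> real"
  assumes "open \<Omega>" "stable_solution \<Omega> u" "has_boundary_data \<Omega> u \<phi>"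
    and \<phi>: "\<And>x. x \<in> frontier \<Omega> \<Longrightarrow> \<phi> x \<le> M" and "limsup_at_infinity_le \<Omega> u M"
    and "x \<in> \<Omega>"
  shows "u x \<le> M"
proof (rule ccontr)
  assume "\<not> u x \<le> M"
  define e where "e = (u x - M) / 2"
  have "e > 0" using \<open>\<not> u x \<le> M\<close> by (simp add: e_def)
  then obtain b where b: "\<And>y. b \<le> norm y \<Longrightarrow> y \<in> \<Omega> \<Longrightarrow> u y \<le> M + e"
    using assms(5) unfolding limsup_at_infinity_le_def eventually_at_infinity by blast
  define K where "K = closure \<Omega> \<inter> cball 0 (max b (norm x))"
  have "compact K" unfolding K_def by (simp add: closed_Int_compact)
  moreover have "x \<in> K" using \<open>x \<in> \<Omega>\<close> closure_subset by (auto simp: K_def)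
  moreover have "continuous_on K u"
    using assms(3) continuous_on_subset unfolding has_boundary_data_def K_def by blast
  ultimately obtain y where y: "y \<in> K" "\<And>z. z \<in> K \<Longrightarrow> u z \<le> u y"
    using continuous_attains_sup[of K u] by blast
  have uxy: "u x \<le> u y" using y(2) \<open>x \<in> K\<close> by simp
  have "y \<notin> frontier \<Omega>"
    using \<phi>[of y] assms(3) \<open>\<not> u x \<le> M\<close> uxy unfolding has_boundary_data_def by auto
  then have "y \<in> \<Omega>"
    using y(1) \<open>open \<Omega>\<close> unfolding K_def by (simp add: frontier_def interior_open)
  have "u z \<le> u y" if "z \<in> \<Omega>" for z
  proof (cases "b \<le> norm z")
    case True
    then have "u z \<le> M + e" using b that by blast
    then show ?thesis using uxy \<open>e > 0\<close> unfolding e_def by (simp add: field_simps)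
  next
    case False
    then have "z \<in> K" using that closure_subset by (auto simp: K_def)
    then show ?thesis by (rule y(2))
  qed
  then have "laplacian u y \<le> 0"
    using laplacian_nonpos_at_max \<open>open \<Omega>\<close> \<open>y \<in> \<Omega>\<close> assms(2) unfolding stable_solution_def by blast
  moreover have "laplacian u y > 0"
    using assms(2) \<open>y \<in> \<Omega>\<close> unfolding stable_solution_def by simp
  ultimately show False by simp
qed

section \<open>The flat function and its derivatives\<close>

text \<open>The classical flat function \<open>exp (- 1/t)\<close>, extended by zero to \<open>t \<le> 0\<close>, together with all its
  derivatives: the \<open>m\<close>-th one is \<open>P\<^sub>m (1/t) exp (- 1/t)\<close> for \<open>t > 0\<close>, and differentiating in \<open>t\<close> gives
  the recursion \<open>P\<^sub>m\<^sub>+\<^sub>1 (s) = s\<^sup>2 (P\<^sub>m (s) - P\<^sub>m' (s))\<close>. Carrying the whole sequence of derivatives makes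
  smoothness an easy induction.\<close>

primrec flat_poly :: "nat \<Rightarrow> real poly" where
  "flat_poly 0 = 1"
| "flat_poly (Suc m) = [:0, 0, 1:] * (flat_poly m - pderiv (flat_poly m))"

definition flat :: "nat \<Rightarrow> real \<Rightarrow> real" where
  "flat m t = (if t > 0 then poly (flat_poly m) (1 / t) * exp (- (1 / t)) else 0)"

lemma poly_times_exp_minus_tendsto_0:
  "((\<lambda>s::real. poly p s * exp (- s)) \<longlongrightarrow> 0) at_top"
proof -
  have "((\<lambda>s::real. \<Sum>i\<le>degree p. coeff p i * (s ^ i / exp s)) \<longlongrightarrow> (\<Sum>i\<le>degree p. coeff p i * 0)) at_top"
    by (intro tendsto_intros tendsto_power_div_exp_0)
  then show ?thesis
    by (simp add: poly_altdef exp_minus sum_distrib_right divide_inverse mult.assoc)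
qed

text \<open>At \<open>t = 0\<close> the difference quotient from the right is again a polynomial in \<open>1/t\<close> times
  \<open>exp (- 1/t)\<close>, which the exponential forces to zero.\<close>

lemma DERIV_flat: "(flat m has_real_derivative flat (Suc m) t) (at t)"
proof -
  consider "t > 0" | "t < 0" | "t = 0" by linarith
  then show ?thesis
  proof cases
    case 1
    have "((\<lambda>t. poly (flat_poly m) (1 / t) * exp (- (1 / t))) has_real_derivative flat (Suc m) t) (at t)"
      using 1 by (auto intro!: derivative_eq_intros DERIV_chain2[OF poly_DERIV]
          simp: flat_def field_simps power2_eq_square)
    then show ?thesis
      by (rule has_field_derivative_transform_within_open[of _ _ _ "{0<..}"])
        (use 1 in \<open>auto simp: flat_def\<close>)
  next
    case 2
    have "((\<lambda>t. 0) has_real_derivative flat (Suc m) t) (at t)"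
      using 2 by (simp add: flat_def)
    then show ?thesis
      by (rule has_field_derivative_transform_within_open[of _ _ _ "{..<0}"])
        (use 2 in \<open>auto simp: flat_def\<close>)
  next
    case 3
    have "((\<lambda>h. (poly (pCons 0 (flat_poly m)) (inverse h) * exp (- inverse h))) \<longlongrightarrow> 0) (at_right 0)"
      by (rule filterlim_compose[OF poly_times_exp_minus_tendsto_0 filterlim_inverse_at_top_right])
    then have R: "((\<lambda>h. flat m h / h) \<longlongrightarrow> 0) (at_right 0)"
      by (rule Lim_transform_eventually)
        (auto intro!: eventually_mono[OF eventually_at_right_less] simp: flat_def field_simps)
    have "((\<lambda>h. 0) \<longlongrightarrow> (0::real)) (at_left 0)" by simp
    then have L: "((\<lambda>h. flat m h / h) \<longlongrightarrow> 0) (at_left 0)"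
      by (rule Lim_transform_eventually)
        (auto simp: flat_def eventually_at_filter)
    show ?thesis
      unfolding has_field_derivative_iff
      using filterlim_split_at[OF L R] 3 by (simp add: flat_def)
  qed
qed

lemma flat_nonneg: "0 \<le> flat 0 t" "0 \<le> flat (Suc 0) t"
  by (auto simp: flat_def)

lemma flat_eq_0: "t \<le> 0 \<Longrightarrow> flat m t = 0"
  by (simp add: flat_def)

section \<open>Sums and products of smooth functions\<close>

lemma Ck_on_Suc_imp_Ck_on: "Ck_on (Suc k) S f \<Longrightarrow> Ck_on k S f"
proof (induction k arbitrary: f)
  case 0
  then show ?case
    by (auto intro!: continuous_at_imp_continuous_on differentiable_imp_continuous_within)
next
  case (Suc k)
  then show ?case by auto
qed

lemma Ck_on_const: "Ck_on k UNIV (\<lambda>x. c)"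
proof (induction k arbitrary: c)
  case (Suc k)
  have "partial_deriv i (\<lambda>x::'a. c) = (\<lambda>x. 0)" for i
    by (rule ext) (rule partial_deriv_eqI[OF has_derivative_const])
  then show ?case using Suc by simp
qed simp

lemma Ck_on_affine: "Ck_on k UNIV (\<lambda>x. c * ((x - a) \<bullet> v))"
proof (cases k)
  case (Suc k')
  have D: "((\<lambda>x. c * ((x - a) \<bullet> v)) has_derivative (\<lambda>h. c * (h \<bullet> v))) (at x)" for x
    by (auto intro!: derivative_eq_intros)
  have "partial_deriv i (\<lambda>x. c * ((x - a) \<bullet> v)) = (\<lambda>x. c * (i \<bullet> v))" for i
    by (rule ext) (rule partial_deriv_eqI[OF D])
  then show ?thesis using Suc D Ck_on_const by (auto simp: differentiable_def)
qed (auto intro!: continuous_intros)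

lemma Ck_on_add: "Ck_on k UNIV f \<Longrightarrow> Ck_on k UNIV g \<Longrightarrow> Ck_on k UNIV (\<lambda>x. f x + g x)"
proof (induction k arbitrary: f g)
  case 0
  then show ?case by (auto intro: continuous_on_add)
next
  case (Suc k)
  have "partial_deriv i (\<lambda>x. f x + g x) = (\<lambda>x. partial_deriv i f x + partial_deriv i g x)" for i
    using Suc.prems
    by (intro ext, subst partial_deriv_eqI[OF has_derivative_add])
      (auto simp: partial_deriv_def simp flip: frechet_derivative_works)
  then show ?case using Suc by auto
qed

lemma Ck_on_mult: "Ck_on k UNIV f \<Longrightarrow> Ck_on k UNIV g \<Longrightarrow> Ck_on k UNIV (\<lambda>x. f x * g x)"
proof (induction k arbitrary: f g)
  case 0
  then show ?case by (auto intro: continuous_on_mult)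
next
  case (Suc k)
  have "partial_deriv i (\<lambda>x. f x * g x) =
      (\<lambda>x. f x * partial_deriv i g x + partial_deriv i f x * g x)" for i
    using Suc.prems
    by (intro ext, subst partial_deriv_eqI[OF has_derivative_mult])
      (auto simp: partial_deriv_def simp flip: frechet_derivative_works)
  then show ?case
    using Suc Ck_on_Suc_imp_Ck_on[OF Suc.prems(1)] Ck_on_Suc_imp_Ck_on[OF Suc.prems(2)]
    by (auto intro!: Ck_on_add)
qed

section \<open>Scaled cutoffs as test functions\<close>

text \<open>For \<open>m = 0\<close> this is a smooth cutoff \<open>\<Psi>\<close> of the unit ball. Differentiating raises the index:
  \<open>D\<Psi>(z) = - 2 \<Phi>(z) z\<close> with the weight \<open>\<Phi>\<close> given by \<open>m = 1\<close>. Both are nonnegative.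
  This relation is why the pair serves as cutoff and averaging kernel below.\<close>

definition bump :: "nat \<Rightarrow> 'a::euclidean_space \<Rightarrow> real" where
  "bump m z = flat m (1 - (norm z)\<^sup>2)"

lemma has_derivative_bump:
  "(bump m has_derivative (\<lambda>h. - 2 * (z \<bullet> h) * bump (Suc m) z)) (at z)"
proof -
  have "((\<lambda>z::'a. 1 - z \<bullet> z) has_derivative (\<lambda>h. - 2 * (z \<bullet> h))) (at z)"
    by (auto intro!: derivative_eq_intros simp: inner_commute)
  from has_derivative_compose[OF this DERIV_flat[of m, unfolded has_field_derivative_def]]
  show ?thesis
    by (simp add: bump_def[abs_def] power2_norm_eq_inner mult_ac)
qed

lemma continuous_on_bump [continuous_intros]:
  fixes f :: "'b::topological_space \<Rightarrow> 'a::euclidean_space"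
  assumes "continuous_on S f"
  shows "continuous_on S (\<lambda>x. bump m (f x))"
proof -
  have "continuous_on UNIV (bump m :: 'a \<Rightarrow> real)"
    by (intro continuous_at_imp_continuous_on ballI has_derivative_continuous[OF has_derivative_bump])
  then show ?thesis
    using assms by (rule continuous_on_compose2) auto
qed

lemma bump_nonneg: "0 \<le> bump 0 z" "0 \<le> bump (Suc 0) z"
  by (simp_all add: bump_def flat_nonneg)

lemma bump_eq_0: "z \<notin> ball 0 1 \<Longrightarrow> bump m z = 0"
  unfolding bump_def by (rule flat_eq_0) (simp add: one_le_power)

lemma bump_eq_0': "z \<notin> cball 0 1 \<Longrightarrow> bump m z = 0"
  by (rule bump_eq_0) auto

lemma has_derivative_scaled_bump:
  "((\<lambda>y. bump m ((y - a) /\<^sub>R s)) has_derivative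
     (\<lambda>h. - 2 / s\<^sup>2 * ((y - a) \<bullet> h) * bump (Suc m) ((y - a) /\<^sub>R s))) (at y)"
proof -
  have "((\<lambda>y. (y - a) /\<^sub>R s) has_derivative (\<lambda>h. h /\<^sub>R s)) (at y)"
    by (auto intro!: derivative_eq_intros)
  from has_derivative_compose[OF this has_derivative_bump[of m]]
  show ?thesis by (simp add: power2_eq_square divide_inverse mult_ac)
qed

lemma partial_deriv_scaled_bump:
  "partial_deriv i (\<lambda>y. bump m ((y - a) /\<^sub>R s)) =
     (\<lambda>y. - 2 / s\<^sup>2 * ((y - a) \<bullet> i) * bump (Suc m) ((y - a) /\<^sub>R s))"
  by (rule ext) (rule partial_deriv_eqI[OF has_derivative_scaled_bump])

text \<open>A partial derivative of a scaled cutoff is the scaled cutoff of the next index times an affine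
  function, so the induction must range over all indices at once.\<close>

lemma smooth_on_scaled_bump: "smooth_on UNIV (\<lambda>y. bump m ((y - a) /\<^sub>R s))"
  unfolding smooth_on_def
proof
  fix k
  show "Ck_on k UNIV (\<lambda>y. bump m ((y - a) /\<^sub>R s))"
  proof (induction k arbitrary: m)
    case 0
    have "continuous_on UNIV (\<lambda>y. bump m ((y - a) /\<^sub>R s))"
      by (intro continuous_at_imp_continuous_on ballI
          has_derivative_continuous[OF has_derivative_scaled_bump])
    then show ?case by simp
  next
    case (Suc k)
    have "(\<lambda>y. bump m ((y - a) /\<^sub>R s)) differentiable (at x)" for x
      using has_derivative_scaled_bump differentiable_def by blast
    moreover have "Ck_on k UNIV (partial_deriv i (\<lambda>y. bump m ((y - a) /\<^sub>R s)))" for i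
      unfolding partial_deriv_scaled_bump by (rule Ck_on_mult[OF Ck_on_affine Suc])
    ultimately show ?case by simp
  qed
qed

lemma scaled_bump_eq_0:
  assumes "s > 0" "y \<notin> cball a s"
  shows "bump m ((y - a) /\<^sub>R s) = 0"
proof (rule bump_eq_0)
  have "1 < norm (y - a) / s"
    using assms by (simp add: dist_norm norm_minus_commute)
  also have "\<dots> = norm ((y - a) /\<^sub>R s)"
    using \<open>s > 0\<close> by (simp add: divide_inverse_commute)
  finally show "(y - a) /\<^sub>R s \<notin> ball 0 1"
    by simp
qed

lemma test_function_scaled_bump:
  assumes "s > 0" "cball a s \<subseteq> \<Omega>"
  shows "test_function \<Omega> (\<lambda>y. bump 0 ((y - a) /\<^sub>R s))"
proof -
  let ?S = "{y. bump 0 ((y - a) /\<^sub>R s) \<noteq> 0}"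
  have "?S \<subseteq> cball a s" using scaled_bump_eq_0[OF assms(1)] by blast
  then have "closure ?S \<subseteq> cball a s" by (simp add: closure_minimal)
  moreover from this have "compact (closure ?S)"
    using bounded_subset[OF bounded_cball] by (simp add: compact_eq_bounded_closed)
  ultimately show ?thesis
    unfolding test_function_def using assms(2) smooth_on_scaled_bump by blast
qed

section \<open>Integrals of compactly supported functions\<close>

lemma integrable_lborel_compact_support:
  fixes f :: "'a::euclidean_space \<Rightarrow> real"
  assumes "compact K" "continuous_on K f" "\<And>x. x \<notin> K \<Longrightarrow> f x = 0"
  shows "integrable lborel f"
proof -
  have "(\<lambda>x. indicator K x *\<^sub>R f x) = f"
    using assms(3) by (auto simp: fun_eq_iff indicator_def)
  then show ?thesis using borel_integrable_compact[OF assms(1,2)] by simp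
qed

lemma set_integral_eq_integral:
  fixes f :: "'a \<Rightarrow> real"
  assumes "\<And>x. x \<notin> A \<Longrightarrow> f x = 0"
  shows "(LINT x:A|M. f x) = (LINT x|M. f x)"
proof -
  have "(\<lambda>x. indicator A x *\<^sub>R f x) = f"
    using assms by (auto simp: fun_eq_iff indicator_def)
  then show ?thesis unfolding set_lebesgue_integral_def by simp
qed

lemma integral_lborel_affine:
  fixes f :: "'a::euclidean_space \<Rightarrow> real"
  assumes [measurable]: "f \<in> borel_measurable borel" and "s > 0"
  shows "integral\<^sup>L lborel f = s ^ DIM('a) * (LINT z|lborel. f (a + s *\<^sub>R z))"
proof -
  have "integral\<^sup>L lborel f =
      integral\<^sup>L (density (distr lborel borel (\<lambda>x. a + s *\<^sub>R x)) (\<lambda>_. ennreal (\<bar>s\<bar> ^ DIM('a)))) f"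
    using lborel_affine[of s a] \<open>s > 0\<close> by simp
  also have "\<dots> = (\<integral>x. \<bar>s\<bar> ^ DIM('a) *\<^sub>R f x \<partial>distr lborel borel (\<lambda>x. a + s *\<^sub>R x))"
    by (rule integral_density) auto
  also have "\<dots> = (\<integral>z. \<bar>s\<bar> ^ DIM('a) *\<^sub>R f (a + s *\<^sub>R z) \<partial>lborel)"
    by (rule integral_distr) auto
  finally show ?thesis using \<open>s > 0\<close> by simp
qed

section \<open>Stability on a ball\<close>

text \<open>The Dirichlet integral of the cutoff of index 0.\<close>

definition bump_energy :: "'a::euclidean_space itself \<Rightarrow> real" where
  "bump_energy _ = (LINT z|lborel. (2 * norm (z::'a) * bump (Suc 0) z)\<^sup>2)"

lemma bump_energy_nonneg: "0 \<le> bump_energy TYPE('a::euclidean_space)"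
  unfolding bump_energy_def by (intro integral_nonneg_AE) auto

text \<open>The stability inequality for the cutoff \<open>\<zeta>(y) = \<Psi>((y - a)/s)\<close>, transported to the unit ball by
  \<open>y = a + s z\<close>. The volume factors \<open>s\<^sup>n\<close> cancel and the gradient contributes \<open>1/s\<^sup>2\<close>, hence the bound
  depends on the dimension only.\<close>

lemma stable_solution_unit_scale:
  fixes u :: "'a::euclidean_space \<Rightarrow> real"
  assumes stab: "stable_solution \<Omega> u" and s: "s > 0" and sub: "cball a s \<subseteq> \<Omega>"
  shows "s\<^sup>2 * (LINT z|lborel. (bump 0 z / u (a + s *\<^sub>R z))\<^sup>2) \<le> bump_energy TYPE('a)"
proof -
  define \<zeta> where "\<zeta> = (\<lambda>y. bump 0 ((y - a) /\<^sub>R s))"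
  have cu: "continuous_on \<Omega> u" and upos: "\<And>x. x \<in> \<Omega> \<Longrightarrow> 0 < u x"
    using stab smooth_onD(4) unfolding stable_solution_def by auto
  have \<zeta>0: "\<zeta> y = 0" if "y \<notin> cball a s" for y
    unfolding \<zeta>_def using scaled_bump_eq_0[OF s that] .
  have \<zeta>\<Omega>: "\<zeta> y = 0" "bump (Suc 0) ((y - a) /\<^sub>R s) = 0" if "y \<notin> \<Omega>" for y
    using scaled_bump_eq_0[OF s, of y a] that sub unfolding \<zeta>_def by blast+
  have g: "(norm (grad \<zeta> y))\<^sup>2 = (2 / s\<^sup>2 * norm (y - a) * bump (Suc 0) ((y - a) /\<^sub>R s))\<^sup>2" for y
  proof -
    have "grad \<zeta> y = (- 2 / s\<^sup>2 * bump (Suc 0) ((y - a) /\<^sub>R s)) *\<^sub>R (\<Sum>i\<in>Basis. ((y - a) \<bullet> i) *\<^sub>R i)"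
      unfolding grad_def \<zeta>_def partial_deriv_scaled_bump scaleR_sum_right
      by (intro sum.cong) (auto simp: mult_ac)
    then show ?thesis
      by (simp add: euclidean_representation power_mult_distrib power_divide)
  qed
  have cb: "continuous_on UNIV (\<lambda>y. bump m ((y - a) /\<^sub>R s))" for m
    by (rule smooth_onD(4)[OF smooth_on_scaled_bump])
  have "continuous_on (cball a s) (\<lambda>y. (\<zeta> y)\<^sup>2 / (u y)\<^sup>2)"
  proof (intro continuous_intros)
    show "continuous_on (cball a s) \<zeta>"
      unfolding \<zeta>_def using cb by (rule continuous_on_subset) simp
    show "continuous_on (cball a s) u"
      by (rule continuous_on_subset[OF cu sub])
    show "\<forall>y\<in>cball a s. (u y)\<^sup>2 \<noteq> 0"
      using sub upos by force
  qed
  then have int1: "integrable lborel (\<lambda>y. (\<zeta> y)\<^sup>2 / (u y)\<^sup>2)"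
    by (rule integrable_lborel_compact_support[OF compact_cball]) (simp add: \<zeta>0 del: mem_cball)
  have "continuous_on (cball a s) (\<lambda>y. (norm (grad \<zeta> y))\<^sup>2)"
    unfolding g by (intro continuous_intros continuous_on_subset[OF cb]) auto
  then have int2: "integrable lborel (\<lambda>y. (norm (grad \<zeta> y))\<^sup>2)"
    by (rule integrable_lborel_compact_support[OF compact_cball])
      (simp add: g scaled_bump_eq_0 s del: mem_cball)
  have "(LINT y:\<Omega>|lborel. (\<zeta> y)\<^sup>2 / (u y)\<^sup>2) = (LINT y|lborel. (\<zeta> y)\<^sup>2 / (u y)\<^sup>2)"
    by (rule set_integral_eq_integral) (use \<zeta>\<Omega> in simp)
  also have "\<dots> = s ^ DIM('a) * (LINT z|lborel. (\<zeta> (a + s *\<^sub>R z))\<^sup>2 / (u (a + s *\<^sub>R z))\<^sup>2)"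
    using int1 s by (intro integral_lborel_affine) auto
  also have "\<dots> = s ^ DIM('a) * (LINT z|lborel. (bump 0 z / u (a + s *\<^sub>R z))\<^sup>2)"
    using s by (simp add: \<zeta>_def power_divide)
  finally have L: "(LINT y:\<Omega>|lborel. (\<zeta> y)\<^sup>2 / (u y)\<^sup>2) =
      s ^ DIM('a) * (LINT z|lborel. (bump 0 z / u (a + s *\<^sub>R z))\<^sup>2)" .
  have "(LINT y:\<Omega>|lborel. (norm (grad \<zeta> y))\<^sup>2) = (LINT y|lborel. (norm (grad \<zeta> y))\<^sup>2)"
    by (rule set_integral_eq_integral) (use \<zeta>\<Omega> in \<open>simp add: g\<close>)
  also have "\<dots> = s ^ DIM('a) * (LINT z|lborel. (norm (grad \<zeta> (a + s *\<^sub>R z)))\<^sup>2)"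
    using int2 s by (intro integral_lborel_affine) auto
  also have "(\<lambda>z. (norm (grad \<zeta> (a + s *\<^sub>R z)))\<^sup>2) =
      (\<lambda>z. (1 / s\<^sup>2) * (2 * norm z * bump (Suc 0) z)\<^sup>2)"
  proof
    fix z
    have "2 / s\<^sup>2 * norm (a + s *\<^sub>R z - a) * bump (Suc 0) ((a + s *\<^sub>R z - a) /\<^sub>R s) =
        (1 / s) * (2 * norm z * bump (Suc 0) z)"
      using s by (simp add: power2_eq_square)
    then show "(norm (grad \<zeta> (a + s *\<^sub>R z)))\<^sup>2 = (1 / s\<^sup>2) * (2 * norm z * bump (Suc 0) z)\<^sup>2"
      unfolding g by (simp only: power_mult_distrib power_divide power_one)
  qed
  finally have R: "(LINT y:\<Omega>|lborel. (norm (grad \<zeta> y))\<^sup>2) =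
      s ^ DIM('a) * (1 / s\<^sup>2 * bump_energy TYPE('a))"
    unfolding bump_energy_def by simp
  have "(LINT y:\<Omega>|lborel. (\<zeta> y)\<^sup>2 / (u y)\<^sup>2) \<le> (LINT y:\<Omega>|lborel. (norm (grad \<zeta> y))\<^sup>2)"
    using stab test_function_scaled_bump[OF s sub] unfolding stable_solution_def \<zeta>_def by blast
  then have "(LINT z|lborel. (bump 0 z / u (a + s *\<^sub>R z))\<^sup>2) \<le> 1 / s\<^sup>2 * bump_energy TYPE('a)"
    unfolding L R using s by (simp only: mult_le_cancel_left_pos zero_less_power)
  then show ?thesis using s by (simp add: field_simps)
qed

text \<open>The Dirichlet integral of the cutoff and the volume of the unit ball are the two terms left
  after the inequality \<open>2ab \<le> a\<^sup>2 + b\<^sup>2\<close> in the next estimate.\<close>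

definition growth_const :: "'a::euclidean_space itself \<Rightarrow> real" where
  "growth_const _ = (bump_energy TYPE('a) + measure lborel (cball (0::'a) 1)) / 2"

lemma growth_const_nonneg: "0 \<le> growth_const TYPE('a::euclidean_space)"
  unfolding growth_const_def by (simp add: bump_energy_nonneg)

text \<open>The heart of the argument: stability controls the mean of \<open>1/u\<^sup>2\<close>, hence the mean of
  \<open>\<Delta>u = 1/u\<close> on a ball of radius \<open>s\<close> by a dimensional constant over \<open>s\<close>. This is the scaling
  of a cone \<open>u = c |x|\<close> and so just misses a Lipschitz bound. The passage from \<open>1/u\<^sup>2\<close> to \<open>1/u\<close> uses
  \<open>2 s \<Psi>/u \<le> s\<^sup>2 \<Psi>\<^sup>2/u\<^sup>2 + 1\<close> on the unit ball. The value \<open>s = 0\<close> is included so that radii can range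
  over a closed interval.\<close>

lemma stable_solution_laplacian_mass:
  fixes u :: "'a::euclidean_space \<Rightarrow> real"
  assumes stab: "stable_solution \<Omega> u" and s: "s \<ge> 0" and sub: "cball a s \<subseteq> \<Omega>"
  shows "0 \<le> s * (LINT z|lborel. bump 0 z / u (a + s *\<^sub>R z))"
    and "s * (LINT z|lborel. bump 0 z / u (a + s *\<^sub>R z)) \<le> growth_const TYPE('a)"
proof -
  have cu: "continuous_on \<Omega> u" and upos: "\<And>x. x \<in> \<Omega> \<Longrightarrow> 0 < u x"
    using stab smooth_onD(4) unfolding stable_solution_def by auto
  have in\<Omega>: "a + s *\<^sub>R z \<in> \<Omega>" if "z \<in> cball 0 1" for z
  proof -
    have "norm (s *\<^sub>R z) \<le> s" using that s by (simp add: mult_left_le)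
    then show ?thesis using sub by (auto simp: dist_norm subset_iff)
  qed
  have cont: "continuous_on (cball 0 1) (\<lambda>z. bump 0 z / u (a + s *\<^sub>R z))"
    using in\<Omega> upos by (force intro!: continuous_intros continuous_on_compose2[OF cu])
  have int1: "integrable lborel (\<lambda>z. bump 0 z / u (a + s *\<^sub>R z))"
    by (rule integrable_lborel_compact_support[OF compact_cball cont]) (simp add: bump_eq_0')
  have int2: "integrable lborel (\<lambda>z. (bump 0 z / u (a + s *\<^sub>R z))\<^sup>2)"
    by (rule integrable_lborel_compact_support[OF compact_cball continuous_on_power[OF cont]])
      (simp add: bump_eq_0')
  have nonneg: "0 \<le> bump 0 z / u (a + s *\<^sub>R z)" for z
    using in\<Omega>[of z] upos[of "a + s *\<^sub>R z"] bump_nonneg(1)[of z] bump_eq_0'[of z 0]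
    by (cases "z \<in> cball 0 1") (auto intro: less_imp_le)
  show "0 \<le> s * (LINT z|lborel. bump 0 z / u (a + s *\<^sub>R z))"
    using s nonneg by (intro mult_nonneg_nonneg integral_nonneg_AE) auto
  have ineq: "s * (bump 0 z / u (a + s *\<^sub>R z)) \<le>
      (s\<^sup>2 * (bump 0 z / u (a + s *\<^sub>R z))\<^sup>2 + indicator (cball 0 1) z) / 2" for z
  proof (cases "z \<in> cball 0 1")
    case True
    have "0 \<le> (s * (bump 0 z / u (a + s *\<^sub>R z)) - 1)\<^sup>2" by simp
    then have "0 \<le> s\<^sup>2 * (bump 0 z / u (a + s *\<^sub>R z))\<^sup>2 + 1 - 2 * (s * (bump 0 z / u (a + s *\<^sub>R z)))"
      by (simp only: power2_diff power_mult_distrib) simp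
    then show ?thesis using True by (simp add: mult_ac)
  qed (simp add: bump_eq_0')
  have int3: "integrable lborel (indicator (cball (0::'a) 1) :: 'a \<Rightarrow> real)"
    by (intro integrable_real_indicator emeasure_compact_finite) auto
  have "s * (LINT z|lborel. bump 0 z / u (a + s *\<^sub>R z)) =
      (LINT z|lborel. s * (bump 0 z / u (a + s *\<^sub>R z)))"
    by (rule integral_mult_right_zero[symmetric])
  also have "\<dots> \<le> (LINT z|lborel. (s\<^sup>2 * (bump 0 z / u (a + s *\<^sub>R z))\<^sup>2 + indicator (cball 0 1) z) / 2)"
    using int2 int3 ineq by (intro integral_mono integrable_mult_right[OF int1]) auto
  also have "\<dots> = (s\<^sup>2 * (LINT z|lborel. (bump 0 z / u (a + s *\<^sub>R z))\<^sup>2) + measure lborel (cball (0::'a) 1)) / 2"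
    using int2 int3 by simp
  also have "\<dots> \<le> growth_const TYPE('a)"
  proof (cases "s = 0")
    case False
    then show ?thesis
      using stable_solution_unit_scale[OF stab _ sub] s unfolding growth_const_def by simp
  qed (simp add: growth_const_def bump_energy_nonneg)
  finally show "s * (LINT z|lborel. bump 0 z / u (a + s *\<^sub>R z)) \<le> growth_const TYPE('a)" .
qed

section \<open>Integration by parts\<close>

text \<open>The solution is meaningful on \<open>\<Omega>\<close> only, while integrals range over the whole space. Multiplying
  by a factor that vanishes off a closed set inside the good region repairs this, whatever
  values the other factor takes elsewhere.\<close>

lemma continuous_on_zero_extension:
  fixes f g :: "'a::t2_space \<Rightarrow> real"
  assumes "continuous_on S g" and "open U" "continuous_on (S \<inter> U) f"
    and "closed K" "S \<inter> K \<subseteq> U" "\<And>x. x \<in> S \<Longrightarrow> x \<notin> K \<Longrightarrow> g x = 0"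
  shows "continuous_on S (\<lambda>x. g x * f x)"
  unfolding continuous_on_eq_continuous_within
proof
  fix x assume x: "x \<in> S"
  have local: "continuous (at x within S) (\<lambda>x. g x * f x)"
    if "open V" "x \<in> V" "continuous_on (S \<inter> V) (\<lambda>x. g x * f x)" for V
  proof -
    have "at x within S = at x within (S \<inter> V)"
      by (rule at_within_nhd[of _ V]) (use that in auto)
    then show ?thesis
      using that x by (simp add: continuous_on_eq_continuous_within)
  qed
  show "continuous (at x within S) (\<lambda>x. g x * f x)"
  proof (cases "x \<in> K")
    case True
    have "continuous_on (S \<inter> U) (\<lambda>x. g x * f x)"
      using assms(1,3) by (auto intro!: continuous_on_mult intro: continuous_on_subset)
    then show ?thesis using local[of U] True x assms(2,5) by blast
  next
    case False
    have "continuous_on (S \<inter> - K) (\<lambda>x. g x * f x) \<longleftrightarrow> continuous_on (S \<inter> - K) (\<lambda>x. 0::real)"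
      by (rule continuous_on_cong) (use assms(6) in auto)
    then show ?thesis using local[of "- K"] False \<open>closed K\<close> by (simp add: open_Compl)
  qed
qed

lemma integral_eq_lborel_integral:
  fixes f :: "'a::euclidean_space \<Rightarrow> real"
  assumes "integrable lborel f" "\<And>x. x \<notin> S \<Longrightarrow> f x = 0"
  shows "integral S f = integral\<^sup>L lborel f"
proof -
  have "(\<lambda>x. if x \<in> S then f x else 0) = f"
    using assms(2) by auto
  then show ?thesis
    using Henstock_Kurzweil_Integration.integral_restrict_UNIV[of S f] integral_lborel[OF assms(1)]
    by simp
qed

lemma integral_lborel_translate:
  fixes f :: "'a::euclidean_space \<Rightarrow> real"
  assumes "f \<in> borel_measurable borel"
  shows "(LINT z|lborel. f (z + a)) = integral\<^sup>L lborel f"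
  using integral_lborel_affine[OF assms zero_less_one, of a] by (simp add: add.commute)

text \<open>The integral of \<open>F (z + t v)\<close> over the space does not depend on \<open>t\<close>, by translation invariance.
  Differentiating under the integral at \<open>t = 0\<close> gives the claim.\<close>

lemma integral_directional_derivative_eq_0:
  fixes F G :: "'a::euclidean_space \<Rightarrow> real"
  assumes contF: "continuous_on UNIV F" and contG: "continuous_on UNIV G"
    and F0: "\<And>z. z \<notin> cball 0 1 \<Longrightarrow> F z = 0" and G0: "\<And>z. z \<notin> cball 0 1 \<Longrightarrow> G z = 0"
    and deriv: "\<And>z t. ((\<lambda>t. F (z + t *\<^sub>R v)) has_real_derivative G (z + t *\<^sub>R v)) (at t)"
    and v: "norm v \<le> 1"
  shows "integral\<^sup>L lborel G = 0"
proof -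
  obtain b :: 'a where b: "cball 0 2 \<subseteq> cbox (- b) b"
    using bounded_subset_cbox_symmetric[OF bounded_cball] .
  \<comment> \<open>For \<open>|t| \<le> 1\<close> all translates are supported in the ball of radius 2, so one box carries
    all the integrals.\<close>
  have out: "z + t *\<^sub>R v \<notin> cball 0 1" if "z \<notin> cbox (- b) b" "\<bar>t\<bar> \<le> 1" for z t
  proof -
    have "norm z > 2" using that(1) b by force
    moreover have "norm (t *\<^sub>R v) \<le> 1" using that(2) v by (simp add: mult_le_one)
    moreover have "norm z \<le> norm (z + t *\<^sub>R v) + norm (t *\<^sub>R v)"
      using norm_triangle_ineq4[of "z + t *\<^sub>R v" "t *\<^sub>R v"] by simp
    ultimately show ?thesis by simp
  qed
  have intF: "integrable lborel F"
    using contF F0 by (intro integrable_lborel_compact_support[of "cball 0 1"])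
      (auto intro: continuous_on_subset)
  have intG: "integrable lborel G"
    using contG G0 by (intro integrable_lborel_compact_support[of "cball 0 1"])
      (auto intro: continuous_on_subset)
  have intFt: "integrable lborel (\<lambda>z. F (z + t *\<^sub>R v))" for t
  proof (rule integrable_lborel_compact_support)
    show "continuous_on (cball (- (t *\<^sub>R v)) 1) (\<lambda>z. F (z + t *\<^sub>R v))"
      by (intro continuous_on_compose2[OF contF] continuous_intros) auto
    show "F (z + t *\<^sub>R v) = 0" if "z \<notin> cball (- (t *\<^sub>R v)) 1" for z
    proof (rule F0)
      have "dist (- (t *\<^sub>R v)) z = norm (z + t *\<^sub>R v)"
        unfolding dist_norm by (subst norm_minus_commute) simp
      then show "z + t *\<^sub>R v \<notin> cball 0 1" using that by simp
    qed
  qed simp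
  define H where "H t = integral (cbox (- b) b) (\<lambda>z. F (z + t *\<^sub>R v))" for t
  have Hconst: "H t = integral\<^sup>L lborel F" if "t \<in> {-1..1}" for t
  proof -
    have "H t = (LINT z|lborel. F (z + t *\<^sub>R v))"
      unfolding H_def using that by (intro integral_eq_lborel_integral[OF intFt] F0 out) auto
    then show ?thesis
      using integral_lborel_translate[OF borel_measurable_continuous_onI[OF contF]] by simp
  qed
  have "(H has_real_derivative integral (cbox (- b) b) (\<lambda>z. G (z + 0 *\<^sub>R v))) (at 0 within {-1..1})"
    unfolding H_def
  proof (rule leibniz_rule_field_derivative[where fx = "\<lambda>t z. G (z + t *\<^sub>R v)"])
    show "((\<lambda>t. F (z + t *\<^sub>R v)) has_real_derivative G (z + t *\<^sub>R v)) (at t within {-1..1})" for t z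
      by (rule has_field_derivative_at_within[OF deriv])
    show "(\<lambda>z. F (z + t *\<^sub>R v)) integrable_on cbox (- b) b" for t
      by (intro integrable_continuous continuous_on_compose2[OF contF] continuous_intros) auto
    show "continuous_on ({-1..1} \<times> cbox (- b) b) (\<lambda>(t, z). G (z + t *\<^sub>R v))"
      unfolding split_beta
      by (intro continuous_on_compose2[OF contG] continuous_intros) auto
  qed auto
  moreover have "at (0::real) within {-1..1} = at 0"
    by (rule at_within_interior) auto
  moreover have "integral (cbox (- b) b) (\<lambda>z. G (z + 0 *\<^sub>R v)) = integral\<^sup>L lborel G"
    using integral_eq_lborel_integral[OF intG, of "cbox (- b) b"] G0 b out[of _ 0] by simp
  ultimately have "(H has_real_derivative integral\<^sup>L lborel G) (at 0)" by simp
  moreover have "(H has_real_derivative 0) (at 0)"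
    by (rule has_field_derivative_transform_within_open[of "\<lambda>_. integral\<^sup>L lborel F" _ _ "{-1<..<1}"])
      (auto simp: Hconst)
  ultimately show ?thesis by (rule DERIV_unique)
qed

section \<open>Radial averages\<close>

text \<open>A weighted mean of \<open>u\<close> over the ball of radius \<open>s\<close> about \<open>a\<close>, written over the unit ball so that
  the radius enters through \<open>u\<close> alone. The kernel is not normalised: its total
  mass is the value for \<open>u = 1\<close>.\<close>

definition radial_average :: "('a::euclidean_space \<Rightarrow> real) \<Rightarrow> 'a \<Rightarrow> real \<Rightarrow> real" where
  "radial_average u a s = (LINT z|lborel. bump (Suc 0) z * u (a + s *\<^sub>R z))"

lemma in_cball_scaleR:
  fixes a z :: "'a::real_normed_vector"
  assumes "0 \<le> s" "s \<le> R" "z \<in> cball 0 r"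
  shows "a + s *\<^sub>R z \<in> cball a (R * r)"
proof -
  have "s * norm z \<le> R * r" using assms by (intro mult_mono) auto
  then show ?thesis using assms by (simp add: dist_norm)
qed

lemma integrable_bump_mult:
  assumes "continuous_on (cball 0 1) g"
  shows "integrable lborel (\<lambda>z. bump m z * g z)"
  by (rule integrable_lborel_compact_support[of "cball 0 1"])
    (use assms in \<open>auto intro!: continuous_intros bump_eq_0\<close>)

lemma integral_bump_mult_sum:
  assumes "\<And>i. i \<in> I \<Longrightarrow> continuous_on (cball 0 1) (g i)"
  shows "(LINT z|lborel. bump m z * (\<Sum>i\<in>I. g i z)) = (\<Sum>i\<in>I. LINT z|lborel. bump m z * g i z)"
  unfolding sum_distrib_left
  by (intro Bochner_Integration.integral_sum integrable_bump_mult assms)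

text \<open>Differentiation under the integral sign over a fixed box containing the unit ball; the kernel
  kills the part of the box that is mapped outside \<open>\<Omega>\<close>.\<close>

lemma DERIV_radial_average:
  fixes u :: "'a::euclidean_space \<Rightarrow> real"
  assumes "open \<Omega>" "smooth_on \<Omega> u" and sub: "cball a R \<subseteq> \<Omega>" and s: "s \<in> {0..R}"
  shows "(radial_average u a has_real_derivative
      (LINT z|lborel. bump (Suc 0) z * (\<Sum>i\<in>Basis. (z \<bullet> i) * partial_deriv i u (a + s *\<^sub>R z))))
      (at s within {0..R})"
proof -
  obtain b :: 'a where b: "cball 0 1 \<subseteq> cbox (- b) b"
    using bounded_subset_cbox_symmetric[OF bounded_cball] .
  define f where "f s z = bump (Suc 0) z * u (a + s *\<^sub>R z)" for s z
  define fs where "fs s z = bump (Suc 0) z * (\<Sum>i\<in>Basis. (z \<bullet> i) * partial_deriv i u (a + s *\<^sub>R z))" for s z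
  have in\<Omega>: "a + t *\<^sub>R z \<in> \<Omega>" if "t \<in> {0..R}" "z \<in> cball 0 1" for t z
    using in_cball_scaleR[of t R z 1 a] that sub by auto
  have contu: "continuous_on \<Omega> u" and contp: "\<And>i. i \<in> Basis \<Longrightarrow> continuous_on \<Omega> (partial_deriv i u)"
    using smooth_onD(4)[OF assms(2)] smooth_onD(4)[OF smooth_onD(3)[OF assms(2)]] by auto
  have intf: "integrable lborel (f t)" if "t \<in> {0..R}" for t
    unfolding f_def using in\<Omega>[OF that]
    by (intro integrable_bump_mult continuous_on_compose2[OF contu] continuous_intros) auto
  have intfs: "integrable lborel (fs t)" if "t \<in> {0..R}" for t
    unfolding fs_def using in\<Omega>[OF that]
    by (intro integrable_bump_mult continuous_on_compose2[OF contp] continuous_intros) auto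
  have "((\<lambda>s. integral (cbox (- b) b) (f s)) has_real_derivative integral (cbox (- b) b) (fs s)) (at s within {0..R})"
  proof (rule leibniz_rule_field_derivative)
    fix t z assume t: "t \<in> {0..R}"
    show "((\<lambda>t. f t z) has_real_derivative fs t z) (at t within {0..R})"
    proof (cases "z \<in> cball 0 1")
      case True
      show ?thesis
        unfolding f_def fs_def
        by (intro DERIV_cmult DERIV_along_line smooth_onD(1)[OF assms(2)] in\<Omega> t True)
    next
      case False
      then show ?thesis by (simp add: f_def fs_def bump_eq_0' del: mem_cball)
    qed
  next
    fix t assume t: "t \<in> {0..R}"
    show "f t integrable_on cbox (- b) b"
      using integrable_on_lborel[OF intf[OF t]] by (rule integrable_on_subcbox) simp
  next
    let ?K = "{p :: real \<times> 'a. norm (snd p) \<le> 1}" and ?U = "{p. a + fst p *\<^sub>R snd p \<in> \<Omega>}"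
    have "open ?U"
      using open_vimage[OF \<open>open \<Omega>\<close>, of "\<lambda>p. a + fst p *\<^sub>R snd p"]
      by (simp add: vimage_def continuous_intros)
    moreover have "closed ?K" by (intro closed_Collect_le continuous_intros)
    moreover have "continuous_on (({0..R} \<times> cbox (- b) b) \<inter> ?U)
        (\<lambda>p. \<Sum>i\<in>Basis. (snd p \<bullet> i) * partial_deriv i u (a + fst p *\<^sub>R snd p))"
      by (intro continuous_on_compose2[OF contp] continuous_intros) auto
    ultimately show "continuous_on ({0..R} \<times> cbox (- b) b) (\<lambda>(t, z). fs t z)"
      unfolding fs_def split_beta
      by (intro continuous_on_zero_extension[of _ _ ?U _ ?K])
        (auto intro!: continuous_intros in\<Omega> bump_eq_0)
  qed (use s in auto)
  moreover have "integral (cbox (- b) b) (f t) = radial_average u a t" if "t \<in> {0..R}" for t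
    unfolding radial_average_def
    by (subst integral_eq_lborel_integral[OF intf[OF that]])
      (use b in \<open>auto simp: f_def[abs_def] simp del: mem_cball intro!: bump_eq_0'\<close>)
  moreover have "integral (cbox (- b) b) (fs s) = integral\<^sup>L lborel (fs s)"
    by (rule integral_eq_lborel_integral[OF intfs[OF s]])
      (use b in \<open>auto simp: fs_def simp del: mem_cball intro!: bump_eq_0'\<close>)
  ultimately show ?thesis
    unfolding has_field_derivative_def
    using has_derivative_transform[OF s, of "radial_average u a" "\<lambda>s. integral (cbox (- b) b) (f s)"]
    by (simp add: fs_def[abs_def])
qed

text \<open>The weight is chosen so that \<open>2 \<Phi>(z) z = - D\<Psi>(z)\<close>. Integrating by parts in each coordinate moves
  the derivative from \<open>\<Psi>\<close> to \<open>Du\<close>, where it acts on \<open>z \<mapsto> Du (a + s z)\<close> and yields the factor \<open>s\<close>.\<close>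

lemma radial_average_integration_by_parts:
  fixes u :: "'a::euclidean_space \<Rightarrow> real"
  assumes "open \<Omega>" "smooth_on \<Omega> u" and sub: "cball a s \<subseteq> \<Omega>" and s: "0 \<le> s"
  shows "2 * (LINT z|lborel. bump (Suc 0) z * (\<Sum>i\<in>Basis. (z \<bullet> i) * partial_deriv i u (a + s *\<^sub>R z)))
       = s * (LINT z|lborel. bump 0 z * laplacian u (a + s *\<^sub>R z))"
proof -
  have in\<Omega>: "a + s *\<^sub>R z \<in> \<Omega>" if "z \<in> cball 0 1" for z
    using in_cball_scaleR[of s s z 1 a] that sub s by auto
  have contp: "continuous_on \<Omega> (partial_deriv i u)"
    and contpp: "continuous_on \<Omega> (partial_deriv i (partial_deriv i u))" if "i \<in> Basis" for i
    using smooth_onD(3)[OF assms(2) that] smooth_onD(4) smooth_onD(3)[OF smooth_onD(3)[OF assms(2) that] that]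
    by auto
  have cp: "continuous_on (cball 0 1) (\<lambda>z. partial_deriv i u (a + s *\<^sub>R z))"
    and cpp: "continuous_on (cball 0 1) (\<lambda>z. partial_deriv i (partial_deriv i u) (a + s *\<^sub>R z))"
    if "i \<in> Basis" for i
    using in\<Omega> by (auto intro!: continuous_on_compose2[OF contp[OF that]]
        continuous_on_compose2[OF contpp[OF that]] continuous_intros)
  let ?U = "{z. a + s *\<^sub>R z \<in> \<Omega>}"
  have openU: "open ?U"
    using open_vimage[OF \<open>open \<Omega>\<close>, of "\<lambda>z. a + s *\<^sub>R z"]
    by (simp add: vimage_def continuous_intros)
  have ext: "continuous_on UNIV (\<lambda>z. g z * w (a + s *\<^sub>R z))"
    if "continuous_on UNIV g" "\<And>z. z \<notin> cball 0 1 \<Longrightarrow> g z = 0" "continuous_on \<Omega> w" for g w :: "'a \<Rightarrow> real"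
    by (rule continuous_on_zero_extension[OF that(1) openU _ closed_cball[of 0 1]])
      (use in\<Omega> in \<open>auto intro!: that(2) continuous_on_compose2[OF that(3)] continuous_intros\<close>)
  \<comment> \<open>One coordinate at a time: the integral of \<open>\<partial>\<^sub>i (\<Psi> \<partial>\<^sub>iu (a + s z))\<close> vanishes.\<close>
  have key: "2 * (LINT z|lborel. bump (Suc 0) z * ((z \<bullet> i) * partial_deriv i u (a + s *\<^sub>R z)))
      = s * (LINT z|lborel. bump 0 z * partial_deriv i (partial_deriv i u) (a + s *\<^sub>R z))"
    if i: "i \<in> Basis" for i
  proof -
    define F where "F z = bump 0 z * partial_deriv i u (a + s *\<^sub>R z)" for z
    define G where "G z = (- 2 * (z \<bullet> i) * bump (Suc 0) z) * partial_deriv i u (a + s *\<^sub>R z)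
        + (s * bump 0 z) * partial_deriv i (partial_deriv i u) (a + s *\<^sub>R z)" for z
    have "integral\<^sup>L lborel G = 0"
    proof (rule integral_directional_derivative_eq_0)
      show "continuous_on UNIV F" unfolding F_def
        by (intro ext contp i continuous_intros) (auto intro: bump_eq_0)
      show "continuous_on UNIV G" unfolding G_def
        by (intro continuous_on_add ext contp contpp i continuous_intros) (auto intro: bump_eq_0)
      show "F z = 0" "G z = 0" if "z \<notin> cball 0 1" for z
        using that by (simp_all add: F_def G_def bump_eq_0' del: mem_cball)
      show "norm i \<le> 1" using i by simp
      fix z t
      show "((\<lambda>t. F (z + t *\<^sub>R i)) has_real_derivative G (z + t *\<^sub>R i)) (at t)"
      proof (cases "z + t *\<^sub>R i \<in> cball 0 1")
        case True
        have eq: "a + s *\<^sub>R (z + t *\<^sub>R i) = (a + s *\<^sub>R z) + (s * t) *\<^sub>R i" for t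
          by (simp add: algebra_simps)
        have "partial_deriv i u differentiable (at ((a + s *\<^sub>R z) + (s * t) *\<^sub>R i))"
          using smooth_onD(2)[OF assms(2) i in\<Omega>[OF True]] unfolding eq .
        from DERIV_along_axis[OF this i]
        have D1: "((\<lambda>t. partial_deriv i u (a + s *\<^sub>R (z + t *\<^sub>R i))) has_real_derivative
            partial_deriv i (partial_deriv i u) (a + s *\<^sub>R (z + t *\<^sub>R i)) * s) (at t)"
          unfolding eq by (rule DERIV_chain2) (auto intro!: derivative_eq_intros)
        have "bump 0 differentiable (at (z + t *\<^sub>R i))"
          using has_derivative_bump differentiable_def by blast
        from DERIV_along_axis[OF this i]
        have D2: "((\<lambda>t. bump 0 (z + t *\<^sub>R i)) has_real_derivative
            - 2 * ((z + t *\<^sub>R i) \<bullet> i) * bump (Suc 0) (z + t *\<^sub>R i)) (at t)"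
          by (simp add: partial_deriv_eqI[OF has_derivative_bump])
        show ?thesis
          unfolding F_def G_def using DERIV_mult[OF D2 D1] by (simp add: mult_ac)
      next
        case False
        define V where "V = (\<lambda>t. z + t *\<^sub>R i) -` (- cball 0 1)"
        have "open V" unfolding V_def by (intro open_vimage continuous_intros) auto
        have "((\<lambda>t. 0) has_real_derivative G (z + t *\<^sub>R i)) (at t)"
          using False by (simp add: G_def bump_eq_0' del: mem_cball)
        then show ?thesis
          by (rule has_field_derivative_transform_within_open[OF _ \<open>open V\<close>])
            (use False in \<open>auto simp: V_def F_def bump_eq_0' simp del: mem_cball\<close>)
      qed
    qed
    moreover have "integrable lborel (\<lambda>z. bump (Suc 0) z * ((z \<bullet> i) * partial_deriv i u (a + s *\<^sub>R z)))"
      by (intro integrable_bump_mult continuous_intros cp i)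
    moreover have "integrable lborel (\<lambda>z. bump 0 z * partial_deriv i (partial_deriv i u) (a + s *\<^sub>R z))"
      by (intro integrable_bump_mult continuous_intros cpp i)
    moreover have "G = (\<lambda>z. (- 2) * (bump (Suc 0) z * ((z \<bullet> i) * partial_deriv i u (a + s *\<^sub>R z)))
        + s * (bump 0 z * partial_deriv i (partial_deriv i u) (a + s *\<^sub>R z)))"
      by (auto simp: G_def fun_eq_iff algebra_simps)
    ultimately show ?thesis
      by (simp add: Bochner_Integration.integral_add del: mult_minus_left)
  qed
  have "2 * (LINT z|lborel. bump (Suc 0) z * (\<Sum>i\<in>Basis. (z \<bullet> i) * partial_deriv i u (a + s *\<^sub>R z)))
      = (\<Sum>i\<in>Basis. 2 * (LINT z|lborel. bump (Suc 0) z * ((z \<bullet> i) * partial_deriv i u (a + s *\<^sub>R z))))"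
    unfolding sum_distrib_left[symmetric]
    by (subst integral_bump_mult_sum) (auto intro!: continuous_intros cp)
  also have "\<dots> = (\<Sum>i\<in>Basis. s * (LINT z|lborel. bump 0 z * partial_deriv i (partial_deriv i u) (a + s *\<^sub>R z)))"
    by (intro sum.cong key refl)
  also have "\<dots> = s * (LINT z|lborel. bump 0 z * laplacian u (a + s *\<^sub>R z))"
    unfolding sum_distrib_left[symmetric] laplacian_def
    by (subst integral_bump_mult_sum) (auto intro!: cpp)
  finally show ?thesis .
qed

definition bump_mass :: "'a::euclidean_space itself \<Rightarrow> real" where
  "bump_mass _ = (LINT z|lborel. bump (Suc 0) (z::'a))"

lemma radial_average_0: "radial_average u (a::'a::euclidean_space) 0 = bump_mass TYPE('a) * u a"
  by (simp add: radial_average_def bump_mass_def)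

text \<open>The kernel is continuous and nonnegative with a positive value at the origin.\<close>

lemma bump_mass_pos: "0 < bump_mass TYPE('a::euclidean_space)"
proof -
  obtain b :: 'a where b: "cball 0 1 \<subseteq> cbox (- b) b"
    using bounded_subset_cbox_symmetric[OF bounded_cball] .
  have int: "integrable lborel (bump (Suc 0) :: 'a \<Rightarrow> real)"
    using integrable_bump_mult[of "\<lambda>_. 1" "Suc 0"] by simp
  have "bump_mass TYPE('a) \<noteq> 0"
  proof
    assume "bump_mass TYPE('a) = 0"
    then have "integral (cbox (- b) b) (bump (Suc 0)) = 0"
      unfolding bump_mass_def
      by (subst integral_eq_lborel_integral[OF int])
        (use b in \<open>auto simp del: mem_cball intro!: bump_eq_0'\<close>)
    moreover have cont: "continuous_on (cbox (- b) b) (bump (Suc 0))"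
      by (intro continuous_intros)
    ultimately have "((bump (Suc 0)) has_integral 0) (cbox (- b) b)"
      using integrable_continuous[OF cont] by (simp add: has_integral_iff)
    moreover have "(0::'a) \<in> box (- b) b"
    proof -
      have "0 < b \<bullet> i" if i: "i \<in> Basis" for i
        using subsetD[OF b, of i] i by (force simp: mem_box inner_Basis)
      then show ?thesis by (simp add: mem_box)
    qed
    ultimately have "bump (Suc 0) (0::'a) = 0"
      using has_integral_0_cbox_imp_0[OF cont bump_nonneg(2), of 0] box_subset_cbox by blast
    then show False by (simp add: bump_def flat_def)
  qed
  moreover have "0 \<le> bump_mass TYPE('a)"
    unfolding bump_mass_def by (intro integral_nonneg_AE) (simp add: bump_nonneg)
  ultimately show ?thesis by simp
qed

text \<open>By \<open>DERIV_radial_average\<close> and the integration by parts, the derivative of the radial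
  average in the radius is half of \<open>s\<close> times the weighted integral of \<open>\<Delta>u = 1/u\<close>, which stability
  bounds uniformly in \<open>s\<close>. So the average deviates from its limit at the centre by at most a constant times the radius.\<close>

lemma stable_solution_radial_average:
  fixes u :: "'a::euclidean_space \<Rightarrow> real"
  assumes "open \<Omega>" "stable_solution \<Omega> u" "cball a R \<subseteq> \<Omega>" "0 \<le> R"
  shows "radial_average u a R - bump_mass TYPE('a) * u a \<in> {0..growth_const TYPE('a) / 2 * R}"
proof -
  have smooth: "smooth_on \<Omega> u" and eq: "\<And>x. x \<in> \<Omega> \<Longrightarrow> laplacian u x = 1 / u x"
    using assms(2) unfolding stable_solution_def by auto
  define D where "D s = (LINT z|lborel. bump (Suc 0) z * (\<Sum>i\<in>Basis. (z \<bullet> i) * partial_deriv i u (a + s *\<^sub>R z)))" for s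
  have "\<exists>s\<in>{0..R}. radial_average u a R - radial_average u a 0 = D s * (R - 0)"
    by (rule mvt_very_simple[OF \<open>0 \<le> R\<close>])
      (use DERIV_radial_average[OF assms(1) smooth assms(3)] in
        \<open>auto simp: D_def has_field_derivative_def\<close>)
  then obtain s where s: "0 \<le> s" "s \<le> R"
    and R: "radial_average u a R - bump_mass TYPE('a) * u a = D s * R"
    by (auto simp: radial_average_0)
  have sub: "cball a s \<subseteq> \<Omega>" using assms(3) s(2) by force
  have "bump 0 z * laplacian u (a + s *\<^sub>R z) = bump 0 z / u (a + s *\<^sub>R z)" for z
  proof (cases "z \<in> cball 0 1")
    case True
    then have "a + s *\<^sub>R z \<in> \<Omega>" using in_cball_scaleR[of s s z 1 a] s(1) sub by auto
    then show ?thesis by (simp add: eq)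
  qed (simp add: bump_eq_0' del: mem_cball)
  then have "2 * D s = s * (LINT z|lborel. bump 0 z / u (a + s *\<^sub>R z))"
    using radial_average_integration_by_parts[OF assms(1) smooth sub s(1)] unfolding D_def by simp
  then have "0 \<le> 2 * D s" "2 * D s \<le> growth_const TYPE('a)"
    using stable_solution_laplacian_mass[OF assms(2) s(1) sub] by simp_all
  then show ?thesis
    unfolding R using \<open>0 \<le> R\<close> mult_right_mono[of "2 * D s" "growth_const TYPE('a)" R] by auto
qed

section \<open>Comparing two points through their averages\<close>

text \<open>The norm of the gradient of the weight at \<open>z\<close> is \<open>2 |z| |bump 2 z|\<close>, so this is the largest
  slope of the weight on the unit ball, and hence everywhere.\<close>

definition bump_lipschitz :: "'a::euclidean_space itself \<Rightarrow> real" where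
  "bump_lipschitz _ = (SUP z\<in>cball (0::'a) 1. 2 * norm z * \<bar>bump 2 z\<bar>)"

lemma bump_Lipschitz:
  fixes x y :: "'a::euclidean_space"
  shows "\<bar>bump (Suc 0) x - bump (Suc 0) y\<bar> \<le> bump_lipschitz TYPE('a) * norm (x - y)"
    and "0 \<le> bump_lipschitz TYPE('a)"
proof -
  let ?g = "\<lambda>z::'a. 2 * norm z * \<bar>bump 2 z\<bar>"
  have "compact (?g ` cball 0 1)"
    by (intro compact_continuous_image continuous_intros) auto
  then have bdd: "bdd_above (?g ` cball 0 1)"
    by (intro bounded_imp_bdd_above compact_imp_bounded)
  have le: "?g z \<le> bump_lipschitz TYPE('a)" if "z \<in> cball 0 1" for z
    unfolding bump_lipschitz_def by (rule cSUP_upper[OF that bdd])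
  show nonneg: "0 \<le> bump_lipschitz TYPE('a)"
    using le[of 0] by simp
  have le': "?g z \<le> bump_lipschitz TYPE('a)" for z
    using le[of z] nonneg bump_eq_0'[of z 2] by (cases "z \<in> cball 0 1") auto
  have "norm (bump (Suc 0) x - bump (Suc 0) y) \<le> bump_lipschitz TYPE('a) * norm (x - y)"
  proof (rule differentiable_bound[OF convex_UNIV])
    fix z :: 'a
    show "(bump (Suc 0) has_derivative (\<lambda>h. - 2 * (z \<bullet> h) * bump 2 z)) (at z within UNIV)"
      using has_derivative_bump[of "Suc 0" z] by (simp add: numeral_2_eq_2)
    show "onorm (\<lambda>h. - 2 * (z \<bullet> h) * bump 2 z) \<le> bump_lipschitz TYPE('a)"
    proof (rule onorm_bound[OF nonneg])
      fix h
      have "norm (- 2 * (z \<bullet> h) * bump 2 z) = 2 * \<bar>bump 2 z\<bar> * \<bar>z \<bullet> h\<bar>"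
        by (simp add: abs_mult)
      also have "\<dots> \<le> 2 * \<bar>bump 2 z\<bar> * (norm z * norm h)"
        by (intro mult_left_mono Cauchy_Schwarz_ineq2) auto
      also have "\<dots> = ?g z * norm h" by simp
      also have "\<dots> \<le> bump_lipschitz TYPE('a) * norm h"
        by (intro mult_right_mono le') auto
      finally show "norm (- 2 * (z \<bullet> h) * bump 2 z) \<le> bump_lipschitz TYPE('a) * norm h" .
    qed
  qed auto
  then show "\<bar>bump (Suc 0) x - bump (Suc 0) y\<bar> \<le> bump_lipschitz TYPE('a) * norm (x - y)"
    by simp
qed

text \<open>A shift of the centre is moved onto the kernel. The two kernels have the same mass, so \<open>u\<close> may
  be replaced by \<open>u - u x\<close>, which the oscillation bounds, while the difference of the
  kernels is of the order of the shift relative to the radius. The shifted kernel lives in the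
  ball of radius 2.\<close>

lemma radial_average_difference:
  fixes u :: "'a::euclidean_space \<Rightarrow> real"
  assumes cont: "continuous_on (cball x (2 * s)) u"
    and s: "0 < s" "norm (x - y) \<le> s"
    and osc: "\<And>w. w \<in> cball x (2 * s) \<Longrightarrow> \<bar>u w - u x\<bar> \<le> \<omega>"
  shows "\<bar>radial_average u x s - radial_average u y s\<bar>
    \<le> bump_lipschitz TYPE('a) * measure lborel (cball (0::'a) 2) * (norm (x - y) / s) * \<omega>"
proof -
  define h where "h = (y - x) /\<^sub>R s"
  have h: "norm h = norm (x - y) / s"
    using s(1) by (simp add: h_def norm_minus_commute divide_inverse_commute)
  have h1: "norm h \<le> 1"
    unfolding h using s by simp
  have y: "y = x + s *\<^sub>R h" using s by (simp add: h_def)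
  have inball: "x + s *\<^sub>R z \<in> cball x (2 * s)" if "z \<in> cball 0 2" for z
    using in_cball_scaleR[of s s z 2 x] that s by (simp add: mult.commute)
  have shift0: "bump (Suc 0) (z - h) = 0" if "z \<notin> cball 0 2" for z
  proof (rule bump_eq_0')
    have "norm z \<le> norm (z - h) + norm h"
      using norm_triangle_ineq[of "z - h" h] by simp
    then show "z - h \<notin> cball 0 1" using that h1 by simp
  qed
  have zero2: "bump (Suc 0) z = 0" if "z \<notin> cball 0 2" for z :: 'a
    using that by (intro bump_eq_0) auto
  have int: "integrable lborel (\<lambda>z. bump (Suc 0) z * g z)"
    and inth: "integrable lborel (\<lambda>z. bump (Suc 0) (z - h) * g z)"
    if "continuous_on (cball 0 2) g" for g :: "'a \<Rightarrow> real"
  proof -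
    show "integrable lborel (\<lambda>z. bump (Suc 0) z * g z)"
    proof (rule integrable_lborel_compact_support[OF compact_cball[of 0 2]])
      show "continuous_on (cball 0 2) (\<lambda>z. bump (Suc 0) z * g z)"
        by (intro continuous_intros that)
    qed (simp add: zero2 del: mem_cball)
    show "integrable lborel (\<lambda>z. bump (Suc 0) (z - h) * g z)"
    proof (rule integrable_lborel_compact_support[OF compact_cball[of 0 2]])
      show "continuous_on (cball 0 2) (\<lambda>z. bump (Suc 0) (z - h) * g z)"
        by (intro continuous_intros that)
    qed (simp add: shift0 del: mem_cball)
  qed
  have contx: "continuous_on (cball 0 2) (\<lambda>z. u (x + s *\<^sub>R z))"
    using inball by (auto intro!: continuous_on_compose2[OF cont] continuous_intros)
  have shift: "(LINT z|lborel. bump (Suc 0) z * g (z + h)) = (LINT z|lborel. bump (Suc 0) (z - h) * g z)"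
    if "continuous_on (cball 0 2) g" for g
    using integral_lborel_translate[of "\<lambda>z. bump (Suc 0) (z - h) * g z" h] inth[OF that] by simp
  have "radial_average u y s = (LINT z|lborel. bump (Suc 0) z * u (x + s *\<^sub>R (z + h)))"
    unfolding radial_average_def y by (simp add: algebra_simps)
  also have "\<dots> = (LINT z|lborel. bump (Suc 0) (z - h) * u (x + s *\<^sub>R z))"
    by (rule shift[OF contx])
  finally have A: "radial_average u x s - radial_average u y s
      = (LINT z|lborel. bump (Suc 0) z * u (x + s *\<^sub>R z)) - (LINT z|lborel. bump (Suc 0) (z - h) * u (x + s *\<^sub>R z))"
    unfolding radial_average_def by simp
  have "(LINT z::'a|lborel. bump (Suc 0) z * u x) = (LINT z|lborel. bump (Suc 0) (z - h) * u x)"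
    by (rule shift[of "\<lambda>_. u x", OF continuous_on_const])
  then have "radial_average u x s - radial_average u y s
      = (LINT z|lborel. bump (Suc 0) z * u (x + s *\<^sub>R z)) - (LINT z|lborel. bump (Suc 0) (z - h) * u (x + s *\<^sub>R z))
        - ((LINT z::'a|lborel. bump (Suc 0) z * u x) - (LINT z|lborel. bump (Suc 0) (z - h) * u x))"
    using A by linarith
  also have "\<dots> = (LINT z|lborel. (bump (Suc 0) z * u (x + s *\<^sub>R z) - bump (Suc 0) (z - h) * u (x + s *\<^sub>R z))
        - (bump (Suc 0) z * u x - bump (Suc 0) (z - h) * u x))"
    using int[OF contx] inth[OF contx] int[OF continuous_on_const] inth[OF continuous_on_const]
    by (simp only: Bochner_Integration.integral_diff Bochner_Integration.integrable_diff)
  also have "\<bar>\<dots>\<bar> \<le> (LINT z|lborel. (bump_lipschitz TYPE('a) * norm h * \<omega>) * indicator (cball (0::'a) 2) z)"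
  proof (rule integral_abs_bound_integral)
    show "integrable lborel (\<lambda>z. (bump (Suc 0) z * u (x + s *\<^sub>R z) - bump (Suc 0) (z - h) * u (x + s *\<^sub>R z))
        - (bump (Suc 0) z * u x - bump (Suc 0) (z - h) * u x))"
      by (intro Bochner_Integration.integrable_diff int inth contx continuous_intros)
    show "integrable lborel (\<lambda>z. (bump_lipschitz TYPE('a) * norm h * \<omega>) * indicator (cball (0::'a) 2) z)"
      by (intro integrable_mult_right integrable_real_indicator emeasure_compact_finite) auto
    fix z
    show "\<bar>(bump (Suc 0) z * u (x + s *\<^sub>R z) - bump (Suc 0) (z - h) * u (x + s *\<^sub>R z))
        - (bump (Suc 0) z * u x - bump (Suc 0) (z - h) * u x)\<bar>
        \<le> (bump_lipschitz TYPE('a) * norm h * \<omega>) * indicator (cball (0::'a) 2) z"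
    proof (cases "z \<in> cball 0 2")
      case True
      have "\<bar>(bump (Suc 0) z * u (x + s *\<^sub>R z) - bump (Suc 0) (z - h) * u (x + s *\<^sub>R z))
        - (bump (Suc 0) z * u x - bump (Suc 0) (z - h) * u x)\<bar>
        = \<bar>bump (Suc 0) z - bump (Suc 0) (z - h)\<bar> * \<bar>u (x + s *\<^sub>R z) - u x\<bar>"
        unfolding abs_mult[symmetric] by (simp add: algebra_simps)
      also have "\<dots> \<le> (bump_lipschitz TYPE('a) * norm h) * \<omega>"
        using bump_Lipschitz(1)[of z "z - h"] bump_Lipschitz(2)[where 'a='a] osc[OF inball[OF True]]
        by (intro mult_mono) auto
      finally show ?thesis using True by simp
    qed (simp add: shift0 zero2 del: mem_cball)
  qed
  also have "\<dots> = bump_lipschitz TYPE('a) * measure lborel (cball (0::'a) 2) * (norm (x - y) / s) * \<omega>"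
    by (simp add: h)
  finally show ?thesis .
qed

text \<open>The difference \<open>u x - u y\<close> is compared with that of the averages at radius \<open>s\<close>. The averages
  exceed the point values, times the mass of the kernel, by an amount between zero and a
  multiple of \<open>s\<close>, so this error enters only once.\<close>

lemma stable_solution_oscillation_step:
  fixes u :: "'a::euclidean_space \<Rightarrow> real"
  defines "C1 \<equiv> growth_const TYPE('a) / (2 * bump_mass TYPE('a))"
    and "C2 \<equiv> bump_lipschitz TYPE('a) * measure lborel (cball (0::'a) 2) / bump_mass TYPE('a)"
  assumes "open \<Omega>" "stable_solution \<Omega> u" and sub: "cball x (2 * s) \<subseteq> \<Omega>"
    and s: "0 < s" "norm (x - y) \<le> s"
    and osc: "\<And>w. w \<in> cball x (2 * s) \<Longrightarrow> \<bar>u w - u x\<bar> \<le> \<omega>"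
  shows "\<bar>u x - u y\<bar> \<le> C1 * s + C2 * (norm (x - y) / s) * \<omega>"
proof -
  let ?k = "bump_mass TYPE('a)" and ?g = "growth_const TYPE('a) / 2 * s"
  let ?b = "bump_lipschitz TYPE('a) * measure lborel (cball (0::'a) 2) * (norm (x - y) / s) * \<omega>"
  have "continuous_on (cball x (2 * s)) u"
    using assms(4) sub smooth_onD(4) continuous_on_subset unfolding stable_solution_def by blast
  from radial_average_difference[OF this s osc]
  have avg: "\<bar>radial_average u x s - radial_average u y s\<bar> \<le> ?b" .
  have "cball x s \<subseteq> cball x (2 * s)" using s by auto
  moreover have "cball y s \<subseteq> cball x (2 * s)"
    using s(2) dist_norm[of x y] by (subst cball_subset_cball_iff) (auto simp: dist_commute)
  ultimately have "cball x s \<subseteq> \<Omega>" "cball y s \<subseteq> \<Omega>" using sub by blast+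
  then have "radial_average u x s - ?k * u x \<in> {0..?g}" "radial_average u y s - ?k * u y \<in> {0..?g}"
    using s(1) by (intro stable_solution_radial_average[OF assms(3,4)]; simp)+
  then have "\<bar>?k * u x - ?k * u y\<bar> \<le> ?g + ?b"
    using avg by (auto simp: abs_le_iff)
  then have "?k * \<bar>u x - u y\<bar> \<le> ?g + ?b"
    using bump_mass_pos[where 'a='a] by (simp add: abs_mult flip: right_diff_distrib)
  then have "\<bar>u x - u y\<bar> \<le> (?g + ?b) / ?k"
    using bump_mass_pos[where 'a='a] by (simp add: field_simps)
  then show ?thesis
    unfolding C1_def C2_def by (simp add: add_divide_distrib mult_ac)
qed

section \<open>Iteration over scales\<close>

text \<open>With \<open>s\<close> half of the current scale and \<open>y\<close> at the next smaller scale, the second term of the step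
  is at most \<open>2 C2 q\<close> times the previous oscillation. If \<open>4 C2 q \<le> \<theta>\<close>, this uses up half of the
  allowed decay \<open>\<theta>\<close>, and the other half absorbs \<open>C1 s\<close> because \<open>q \<le> \<theta>\<close> and
  \<open>C1 \<rho> \<le> A \<theta>\<close>. The centre \<open>x\<close> never moves, since the step only asks for
  the oscillation relative to \<open>x\<close>; thus no domain shrinks.\<close>

lemma geometric_decay_of_oscillation:
  fixes f :: "'a::real_normed_vector \<Rightarrow> real"
  assumes step: "\<And>s \<omega> y. 0 < s \<Longrightarrow> 2 * s \<le> \<rho> \<Longrightarrow> norm (x - y) \<le> s \<Longrightarrow>
        (\<And>w. w \<in> cball x (2 * s) \<Longrightarrow> \<bar>f w - f x\<bar> \<le> \<omega>) \<Longrightarrow>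
        \<bar>f x - f y\<bar> \<le> C1 * s + C2 * (norm (x - y) / s) * \<omega>"
    and bound: "\<And>w. w \<in> cball x \<rho> \<Longrightarrow> \<bar>f w - f x\<bar> \<le> A"
    and pos: "0 < \<rho>" "0 \<le> C1" "0 \<le> C2" "0 \<le> A"
    and q: "0 < q" "q \<le> 1 / 2" "q \<le> \<theta>" "4 * C2 * q \<le> \<theta>" "C1 * \<rho> \<le> A * \<theta>"
  shows "norm (x - y) \<le> q ^ k * \<rho> \<Longrightarrow> \<bar>f x - f y\<bar> \<le> A * \<theta> ^ k"
proof (induction k arbitrary: y)
  case 0
  then show ?case using bound[of y] by (simp add: dist_norm abs_minus_commute)
next
  case (Suc k)
  define s where "s = q ^ k * \<rho> / 2"
  have "\<theta> > 0" using q by linarith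
  have s: "0 < s" "2 * s \<le> \<rho>"
    using pos q by (auto simp: s_def power_le_one)
  have r: "norm (x - y) / s \<le> 2 * q"
  proof -
    have "norm (x - y) \<le> 2 * q * s" using Suc.prems by (simp add: s_def)
    then show ?thesis using s(1) by (simp add: field_simps)
  qed
  moreover have "norm (x - y) / s \<le> 1" using r q(2) by linarith
  ultimately have xy: "norm (x - y) \<le> s" using s(1) by simp
  have osc: "\<bar>f w - f x\<bar> \<le> A * \<theta> ^ k" if "w \<in> cball x (2 * s)" for w
    using Suc.IH[of w] that by (simp add: s_def dist_norm abs_minus_commute)
  have "\<bar>f x - f y\<bar> \<le> C1 * s + C2 * (norm (x - y) / s) * (A * \<theta> ^ k)"
    by (rule step[OF s xy osc])
  also have "C2 * (norm (x - y) / s) * (A * \<theta> ^ k) \<le> C2 * (2 * q) * (A * \<theta> ^ k)"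
    using r pos \<open>\<theta> > 0\<close> by (intro mult_right_mono mult_left_mono) auto
  also have "C2 * (2 * q) * (A * \<theta> ^ k) = (4 * C2 * q) * (A * \<theta> ^ k) / 2" by simp
  also have "(4 * C2 * q) * (A * \<theta> ^ k) / 2 \<le> \<theta> * (A * \<theta> ^ k) / 2"
    using q(4) pos \<open>\<theta> > 0\<close> by (intro divide_right_mono mult_right_mono) auto
  also have "C1 * s = (C1 * \<rho>) * q ^ k / 2" by (simp add: s_def)
  also have "(C1 * \<rho>) * q ^ k / 2 \<le> (A * \<theta>) * \<theta> ^ k / 2"
    using q pos \<open>\<theta> > 0\<close> by (intro divide_right_mono mult_mono[of "C1 * \<rho>"] power_mono) auto
  finally show ?case by (simp add: mult_ac)
qed

text \<open>Choose the scale \<open>k\<close> with \<open>q\<^sup>k\<^sup>+\<^sup>1 \<rho> < d y \<le> q\<^sup>k \<rho>\<close>; the bound at that scale loses only a factor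
  \<open>q powr (- \<alpha>)\<close>.\<close>

lemma powr_bound_of_geometric_decay:
  fixes g :: "'a \<Rightarrow> real"
  assumes decay: "\<And>k y. d y \<le> q ^ k * \<rho> \<Longrightarrow> g y \<le> A * (q powr \<alpha>) ^ k"
    and pos: "0 < q" "q < 1" "0 < \<rho>" "0 \<le> A" "0 < \<alpha>"
    and y: "0 < d y" "d y \<le> \<rho>"
  shows "g y \<le> A * (q * \<rho>) powr (- \<alpha>) * d y powr \<alpha>"
proof -
  obtain n where n: "q ^ n < d y / \<rho>"
    using real_arch_pow_inv[of "d y / \<rho>" q] pos y by auto
  define m where "m = (LEAST n. q ^ n < d y / \<rho>)"
  have m: "q ^ m < d y / \<rho>"
    unfolding m_def by (rule LeastI[of _ n]) (rule n)
  have "m \<noteq> 0"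
    using m y pos by (intro notI) (simp add: field_simps)
  then obtain k where k: "m = Suc k" using not0_implies_Suc by blast
  have "\<not> q ^ k < d y / \<rho>"
    using not_less_Least[of k "\<lambda>n. q ^ n < d y / \<rho>"] k unfolding m_def by simp
  then have "d y \<le> q ^ k * \<rho>" using pos by (simp add: field_simps)
  then have "g y \<le> A * (q powr \<alpha>) ^ k" by (rule decay)
  also have "(q powr \<alpha>) ^ k = (q ^ k) powr \<alpha>"
    using pos by (simp add: powr_power powr_realpow[symmetric] powr_powr mult.commute)
  also have "(q ^ k) powr \<alpha> \<le> (d y / (q * \<rho>)) powr \<alpha>"
    using m pos k by (intro powr_mono2) (auto simp: field_simps)
  also have "(d y / (q * \<rho>)) powr \<alpha> = (q * \<rho>) powr (- \<alpha>) * d y powr \<alpha>"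
    using pos y by (simp add: powr_divide powr_minus field_simps)
  finally show ?thesis using pos by (simp add: mult_left_mono mult.assoc)
qed

text \<open>This is where \<open>\<alpha> < 1\<close> enters: the condition reads \<open>C q powr (1 - \<alpha>) \<le> 1\<close>, and small \<open>q\<close> satisfy it.\<close>

lemma exists_small_ratio:
  fixes C \<alpha> :: real
  assumes "0 \<le> C" "0 < \<alpha>" "\<alpha> < 1"
  obtains q where "0 < q" "q \<le> 1 / 2" "C * q \<le> q powr \<alpha>"
proof
  define q where "q = (1 / (C + 2)) powr (1 / (1 - \<alpha>))"
  show "0 < q" using assms by (simp add: q_def)
  have "q \<le> (1 / (C + 2)) powr 1"
    unfolding q_def using assms by (intro powr_mono') auto
  also have "\<dots> = 1 / (C + 2)" using assms by simp
  also have "\<dots> \<le> 1 / 2" using assms by (simp add: field_simps)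
  finally show "q \<le> 1 / 2" .
  have "q powr (1 - \<alpha>) = 1 / (C + 2)"
    unfolding q_def powr_powr using assms by simp
  then have "C * q powr (1 - \<alpha>) = C / (C + 2)" by simp
  also have "\<dots> \<le> 1" using assms by (simp add: field_simps)
  finally have le1: "C * q powr (1 - \<alpha>) \<le> 1" .
  have "C * q = (C * q powr (1 - \<alpha>)) * q powr \<alpha>"
    using \<open>0 < q\<close> by (simp add: mult.assoc flip: powr_add)
  also have "\<dots> \<le> 1 * q powr \<alpha>"
    by (intro mult_right_mono le1) simp
  finally show "C * q \<le> q powr \<alpha>" by simp
qed

section \<open>The Hoelder estimate\<close>

theorem theorem2:
  fixes \<Omega> \<Omega>' :: "(real ^ 'n) set" and M \<alpha> :: real
  assumes "open \<Omega>" and "connected \<Omega>" and "\<Omega> \<noteq> {}"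
    and "compact (closure \<Omega>')" and "closure \<Omega>' \<subseteq> \<Omega>"
    and "0 < \<alpha>" and "\<alpha> < 1"
  shows "\<exists>C. \<forall>u \<phi>. stable_solution \<Omega> u \<and> has_boundary_data \<Omega> u \<phi> \<and>
           (\<forall>x\<in>frontier \<Omega>. \<phi> x \<le> M) \<and> limsup_at_infinity_le \<Omega> u M \<longrightarrow>
           (\<forall>x\<in>\<Omega>'. \<forall>y\<in>\<Omega>'. \<bar>u x - u y\<bar> \<le> C * norm (x - y) powr \<alpha>)"
proof -
  let ?T = "TYPE(real ^ 'n)"
  define C1 where "C1 = growth_const ?T / (2 * bump_mass ?T)"
  define C2 where "C2 = bump_lipschitz ?T * measure lborel (cball (0 :: real ^ 'n) 2) / bump_mass ?T"
  have C: "0 \<le> C1" "0 \<le> C2"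
    using bump_mass_pos[where 'a="real ^ 'n"] bump_Lipschitz(2)[where 'a="real ^ 'n"] growth_const_nonneg[where 'a="real ^ 'n"]
    unfolding C1_def C2_def by simp_all
  obtain \<rho> where \<rho>: "0 < \<rho>" "(\<Union>x\<in>closure \<Omega>'. cball x \<rho>) \<subseteq> \<Omega>"
    using compact_subset_open_imp_cball_epsilon_subset[OF assms(4,1,5)] .
  obtain q where q: "0 < q" "q \<le> 1 / 2" "4 * C2 * q \<le> q powr \<alpha>"
    using exists_small_ratio[of "4 * C2" \<alpha>] C assms(6,7) by auto
  \<comment> \<open>The first summand bounds the oscillation at the largest scale, the second makes room for the
    error term in every step.\<close>
  define A where "A = \<bar>M\<bar> + C1 * \<rho> / q powr \<alpha>"
  have A: "\<bar>M\<bar> \<le> A" "0 \<le> A" "C1 * \<rho> \<le> A * q powr \<alpha>"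
    using C \<rho> q by (auto simp: A_def field_simps)
  have "\<bar>u x - u y\<bar> \<le> A * (q * \<rho>) powr (- \<alpha>) * norm (x - y) powr \<alpha>"
    if u: "stable_solution \<Omega> u" "has_boundary_data \<Omega> u \<phi>" "\<And>x. x \<in> frontier \<Omega> \<Longrightarrow> \<phi> x \<le> M"
      "limsup_at_infinity_le \<Omega> u M" and x: "x \<in> \<Omega>'" and y: "y \<in> \<Omega>'" for u \<phi> x y
  proof -
    have range: "0 < u w" "u w \<le> M" if "w \<in> \<Omega>" for w
      using u(1) stable_solution_le[OF assms(1) u that] that unfolding stable_solution_def by auto
    have osc: "\<bar>u v - u w\<bar> \<le> A" if "v \<in> \<Omega>" "w \<in> \<Omega>" for v w
      using range[OF that(1)] range[OF that(2)] A(1) by linarith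
    have sub: "cball x \<rho> \<subseteq> \<Omega>" using \<rho>(2) x closure_subset by blast
    have xy: "x \<in> \<Omega>" "y \<in> \<Omega>" using x y assms(5) closure_subset by blast+
    consider "x = y" | "\<rho> < norm (x - y)" | "0 < norm (x - y)" "norm (x - y) \<le> \<rho>"
      by (metis linorder_not_less right_minus_eq zero_less_norm_iff)
    then show ?thesis
    proof cases
      case 2
      \<comment> \<open>Distant points need only \<open>0 < u \<le> M\<close>.\<close>
      have "\<bar>u x - u y\<bar> \<le> A * 1" using osc xy by simp
      also have "1 \<le> (norm (x - y) / (q * \<rho>)) powr \<alpha>"
      proof (rule ge_one_powr_ge_zero)
        have "q * \<rho> \<le> 1 * \<rho>" using q \<rho> by (intro mult_right_mono) auto
        then have "q * \<rho> \<le> norm (x - y)" using 2 by linarith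
        then show "1 \<le> norm (x - y) / (q * \<rho>)" using q \<rho> by (simp add: le_divide_eq)
      qed (use assms(6) in simp)
      also have "(norm (x - y) / (q * \<rho>)) powr \<alpha> = (q * \<rho>) powr (- \<alpha>) * norm (x - y) powr \<alpha>"
        using q \<rho> by (simp add: powr_divide powr_minus field_simps)
      finally show ?thesis using A(2) by (simp add: mult_left_mono mult.assoc)
    next
      case 3
      have decay: "\<bar>u x - u y\<bar> \<le> A * (q powr \<alpha>) ^ k" if "norm (x - y) \<le> q ^ k * \<rho>" for k y
      proof (rule geometric_decay_of_oscillation[where \<rho> = \<rho> and f = u and q = q and k = k and ?C1.0 = C1 and ?C2.0 = C2])
        show "\<bar>u x - u y\<bar> \<le> C1 * s + C2 * (norm (x - y) / s) * \<omega>"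
          if "0 < s" "2 * s \<le> \<rho>" "norm (x - y) \<le> s"
            "\<And>w. w \<in> cball x (2 * s) \<Longrightarrow> \<bar>u w - u x\<bar> \<le> \<omega>" for s \<omega> y
          unfolding C1_def C2_def
          by (rule stable_solution_oscillation_step[OF assms(1) u(1) _ that(1,3,4)])
            (use sub that(2) in force)+
        show "\<bar>u w - u x\<bar> \<le> A" if "w \<in> cball x \<rho>" for w
          using osc sub that xy by blast
        show "q \<le> q powr \<alpha>"
          using powr_mono'[of \<alpha> 1 q] q assms(7) by simp
      qed (use \<rho> C A q that in auto)
      show ?thesis
        by (rule powr_bound_of_geometric_decay[where d = "\<lambda>y. norm (x - y)" and \<rho> = \<rho>, OF decay])
          (use q \<rho>(1) A assms(6) 3 in linarith)+
    qed simp
  qed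
  then show ?thesis by blast
qed

end
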